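(* Let $c\in\mathbb{R}^d$, $r>0$, $k\ge1$ an integer, $0<\varepsilon,\delta<1$, and let $P\subseteq\mathrm{ring}(c,r,2r)$ with $|P|=n$. Let $D\subseteq P$ be a uniform random sample of size $m=\tilde O(\frac{k}{\varepsilon^5}\log\delta^{-1})$, re-weighted so that $w_D(x)=\frac nm$ for all $x\in D$. Then with probability at least $1-\delta$, $D$ is an assignment-preserving $(\varepsilon,nr)$-coreset for $k$-Median on $P$.
   Context: Distances are Euclidean, $\mathrm{dist}(x,y)=\|x-y\|_2$; $\mathrm{ring}(c,a,b)=\{x:a<\|x-c\|_2\le b\}$. $k$-Median is $(k,z)$-Clustering with $z=1$. For a finite weighted set $Q$ (unit weights if unweighted) and finite $C\subseteq\mathbb{R}^d$, an assignment constraint is $\Gamma:C\to\mathbb{R}_{\ge0}$ with $\sum_u\Gamma(u)=w_Q(Q)$; $\sigma:Q\times C\to\mathbb{R}_{\ge0}$ is consistent with $\Gamma$ if $\sum_u\sigma(x,u)=w_Q(x)$ for all $x\in Q$ and $\sum_x\sigma(x,u)=\Gamma(u)$ for all $u\in C$; $\mathrm{cost}(Q,C,\Gamma)=\min_{\sigma\text{ consistent}}\sum_{x,u}\sigma(x,u)\|x-u\|_2$. A weighted set $D$ with $w_D(D)=w_P(P)$ is an assignment-preserving $(\varepsilon,A)$-coreset for $k$-Median on $P$ if for every $C\subseteq\mathbb{R}^d$ with $|C|\le k$ and every assignment constraint $\Gamma$ on $C$, $|\mathrm{cost}(P,C,\Gamma)-\mathrm{cost}(D,C,\Gamma)|\le\varepsilon(\mathrm{cost}(P,C,\Gamma)+A)$.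 $\tilde O$ hides polylogarithmic factors.
   Formalization: The factor log(1/δ) in the sample size is read as max(1, ln(1/δ)), since for δ near 1 the literal bound would allow a one-point sample, for which the claim fails; D is a uniformly random m-element subset of P (so m ≤ n). *)

theory Defs
  imports "HOL-Analysis.L2_Norm" "HOL-Probability.Probability_Mass_Function"
begin

text \<open>
  The dimension \<open>d\<close> is a natural number rather than a type, so that a statement can assert the
  existence of constants that do not depend on \<open>d\<close>: a point of \<open>\<real>\<^sup>d\<close> is a
  sequence vanishing from index \<open>d\<close> on.
\<close>

type_synonym pt = "nat \<Rightarrow> real"

definition Rspace :: "nat \<Rightarrow> pt set" where
  "Rspace d = {x. \<forall>i\<ge>d. x i = 0}"

definition edist :: "nat \<Rightarrow> pt \<Rightarrow> pt \<Rightarrow> real" where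
  "edist d x y = L2_set (\<lambda>i. x i - y i) {..<d}"

definition annulus :: "nat \<Rightarrow> pt \<Rightarrow> real \<Rightarrow> real \<Rightarrow> pt set" where
  "annulus d c a b = {x \<in> Rspace d. a < edist d x c \<and> edist d x c \<le> b}"

definition assignment_constraint ::
    "pt set \<Rightarrow> (pt \<Rightarrow> real) \<Rightarrow> pt set \<Rightarrow> (pt \<Rightarrow> real) \<Rightarrow> bool" where
  "assignment_constraint Q w C \<Gamma> \<longleftrightarrow>
     (\<forall>u\<in>C. 0 \<le> \<Gamma> u) \<and> (\<Sum>u\<in>C. \<Gamma> u) = (\<Sum>x\<in>Q. w x)"

definition consistent ::
    "pt set \<Rightarrow> (pt \<Rightarrow> real) \<Rightarrow> pt set \<Rightarrow> (pt \<Rightarrow> real) \<Rightarrow> (pt \<Rightarrow> pt \<Rightarrow> real) \<Rightarrow> bool" where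
  "consistent Q w C \<Gamma> \<sigma> \<longleftrightarrow>
     (\<forall>x\<in>Q. \<forall>u\<in>C. 0 \<le> \<sigma> x u) \<and>
     (\<forall>x\<in>Q. (\<Sum>u\<in>C. \<sigma> x u) = w x) \<and>
     (\<forall>u\<in>C. (\<Sum>x\<in>Q. \<sigma> x u) = \<Gamma> u)"

text \<open>
  The infimum below is a minimum whenever \<open>\<Gamma>\<close> is an assignment constraint for a
  nonnegatively weighted finite set: the consistent assignments then form a nonempty compact
  polytope.
\<close>

definition cost ::
    "nat \<Rightarrow> pt set \<Rightarrow> (pt \<Rightarrow> real) \<Rightarrow> pt set \<Rightarrow> (pt \<Rightarrow> real) \<Rightarrow> real" where
  "cost d Q w C \<Gamma> =
     (INF \<sigma> \<in> {\<sigma>. consistent Q w C \<Gamma> \<sigma>}. \<Sum>x\<in>Q. \<Sum>u\<in>C. \<sigma> x u * edist d x u)"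

definition assignment_preserving_coreset ::
    "nat \<Rightarrow> nat \<Rightarrow> real \<Rightarrow> real \<Rightarrow> pt set \<Rightarrow> (pt \<Rightarrow> real) \<Rightarrow> pt set \<Rightarrow> (pt \<Rightarrow> real) \<Rightarrow> bool" where
  "assignment_preserving_coreset d k \<epsilon> A P w\<^sub>P D w\<^sub>D \<longleftrightarrow>
     finite D \<and> D \<subseteq> Rspace d \<and> (\<forall>x\<in>D. 0 \<le> w\<^sub>D x) \<and>
     (\<Sum>x\<in>D. w\<^sub>D x) = (\<Sum>x\<in>P. w\<^sub>P x) \<and>
     (\<forall>C \<Gamma>. C \<subseteq> Rspace d \<and> finite C \<and> card C \<le> k \<and> assignment_constraint P w\<^sub>P C \<Gamma> \<longrightarrow>
        \<bar>cost d P w\<^sub>P C \<Gamma> - cost d D w\<^sub>D C \<Gamma>\<bar> \<le> \<epsilon> * (cost d P w\<^sub>P C \<Gamma> + A))"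

text \<open>
  The quantity \<open>(k / \<epsilon>\<^sup>5) log \<delta>\<^sup>-\<^sup>1\<close> under the soft-O. As usual in
  asymptotic bounds, the logarithm is read as at least \<open>1\<close>; otherwise it would tend
  to \<open>0\<close> as \<open>\<delta>\<close> tends to \<open>1\<close> and the bound would allow samples of size \<open>1\<close>.
\<close>

definition base_size :: "nat \<Rightarrow> real \<Rightarrow> real \<Rightarrow> real" where
  "base_size k \<epsilon> \<delta> = real k / \<epsilon> ^ 5 * max 1 (ln (1 / \<delta>))"

text \<open>
  \<open>soft_O K q f\<close> is a generic member of the class \<open>f polylog(f)\<close>, with leading
  constant \<open>K\<close> and logarithmic exponent \<open>q\<close>.
\<close>

definition soft_O :: "real \<Rightarrow> nat \<Rightarrow> real \<Rightarrow> real" where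
  "soft_O K q f = K * f * ln (2 + f) ^ q"

definition uniform_sample :: "pt set \<Rightarrow> nat \<Rightarrow> pt set pmf" where
  "uniform_sample P m = pmf_of_set {D. D \<subseteq> P \<and> card D = m}"

end

theory Submission
  imports Defs "HOL-Probability.Hoeffding" "HOL-Analysis.Function_Topology"
begin

text \<open>
  By linear programming duality for transportation problems, the cost under the constraint \<open>\<Gamma>\<close> is the
  supremum over \<open>g\<close> of \<open>\<Sum>\<^sub>x w(x) min\<^sub>u (\<parallel>x - u\<parallel> - g(u)) + \<Sum>\<^sub>u \<Gamma>(u) g(u)\<close>. Hence it suffices that
  the sample averages of all functions \<open>\<phi>(x) = min\<^sub>u (\<parallel>x - u\<parallel> - g(u))\<close> are within \<open>\<epsilon> r\<close> of their
  population averages; these functions have oscillation at most \<open>4 r\<close> on the ring.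

  On \<open>N\<close> points and up to additive constants, the functions \<open>\<phi>\<close> have a uniform cover of cardinality
  \<open>exp (O(k \<epsilon>\<^sup>-\<^sup>2 log N))\<close>, independently of the dimension: seen from the nearest data point \<open>x0\<close>, the
  direction of \<open>u\<close> is replaced by a combination of \<open>O(\<epsilon>\<^sup>-\<^sup>2)\<close> signed normalised differences \<open>x - x0\<close>
  found by the perceptron algorithm. Symmetrisation with a ghost sample makes \<open>N = 2 m\<close>, and
  Hoeffding's inequality for sampling without replacement with a union bound gives a sample size
  of order \<open>k \<epsilon>\<^sup>-\<^sup>4\<close> up to logarithms.
\<close>

section \<open>Hoeffding's inequality for sampling without replacement\<close>

abbreviation subsets_of_size :: "'a set \<Rightarrow> nat \<Rightarrow> 'a set set" where
  "subsets_of_size S m \<equiv> {D. D \<subseteq> S \<and> card D = m}"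

abbreviation avg :: "'a set \<Rightarrow> ('a \<Rightarrow> real) \<Rightarrow> real" where
  "avg S f \<equiv> (\<Sum>x\<in>S. f x) / real (card S)"

text \<open>The uniform distribution on \<open>S\<close> turns Hoeffding's lemma into an inequality
  between finite sums, the form needed in the induction over draws.\<close>

lemma Hoeffdings_lemma_finite:
  fixes f :: "'a \<Rightarrow> real"
  assumes "finite S" "S \<noteq> {}" "\<And>x. x \<in> S \<Longrightarrow> f x \<in> {a..b}" "l \<ge> 0"
  shows "(\<Sum>x\<in>S. exp (l * (f x - avg S f))) \<le> card S * exp (l\<^sup>2 * (b - a)\<^sup>2 / 8)"
proof (cases "l = 0")
  case False
  let ?p = "pmf_of_set S"
  interpret interval_bounded_random_variable "measure_pmf ?p" f a b
    by unfold_locales (use assms in \<open>auto simp: AE_measure_pmf_iff\<close>)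
  have E: "measure_pmf.expectation ?p f = avg S f"
    using integral_pmf_of_set[OF assms(2,1), of f] by simp
  have c: "card S > 0" using assms by (simp add: card_gt_0_iff)
  have "nn_integral ?p (\<lambda>x. exp (l * (f x - measure_pmf.expectation ?p f))) \<le> ennreal (exp (l\<^sup>2 * (b - a)\<^sup>2 / 8))"
    using Hoeffdings_lemma_nn_integral[of l] False assms by simp
  also have "nn_integral ?p (\<lambda>x. exp (l * (f x - measure_pmf.expectation ?p f)))
      = ennreal ((\<Sum>x\<in>S. exp (l * (f x - avg S f))) / card S)"
    using assms c by (simp add: E nn_integral_pmf_of_set sum_nonneg divide_ennreal ennreal_of_nat_eq_real_of_nat)
  finally have "(\<Sum>x\<in>S. exp (l * (f x - avg S f))) / card S \<le> exp (l\<^sup>2 * (b - a)\<^sup>2 / 8)"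
    by simp
  then show ?thesis using c by (simp add: field_simps)
qed simp

text \<open>Double counting of pairs of a set and a marked element of it. The marked element plays
  the first draw, which makes induction on the sample size possible.\<close>

lemma sum_subsets_of_size_Suc:
  fixes F :: "'a set \<Rightarrow> real"
  assumes "finite S"
  shows "real (Suc m) * (\<Sum>D\<in>subsets_of_size S (Suc m). F D) =
    (\<Sum>x\<in>S. \<Sum>D\<in>subsets_of_size (S - {x}) m. F (insert x D))"
proof -
  have "real (Suc m) * (\<Sum>D\<in>subsets_of_size S (Suc m). F D) =
      (\<Sum>D\<in>subsets_of_size S (Suc m). \<Sum>x\<in>D. F D)"
    by (simp add: sum_distrib_left)
  also have "\<dots> = (\<Sum>(D, x)\<in>(SIGMA D:subsets_of_size S (Suc m). D). F D)"
    using assms by (subst sum.Sigma) (auto intro: finite_subset)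
  also have "\<dots> = (\<Sum>(x, D)\<in>(SIGMA x:S. subsets_of_size (S - {x}) m). F (insert x D))"
    by (rule sum.reindex_bij_witness[where i = "\<lambda>(x, D). (insert x D, x)" and j = "\<lambda>(D, x). (x, D - {x})"])
      (use assms finite_subset[of _ S] in \<open>auto simp: insert_absorb card_insert_disjoint Diff_insert0 subset_Diff_insert\<close>)
  also have "\<dots> = (\<Sum>x\<in>S. \<Sum>D\<in>subsets_of_size (S - {x}) m. F (insert x D))"
    using assms by (subst sum.Sigma) auto
  finally show ?thesis .
qed

text \<open>Drawing the first point \<open>x\<close> shifts the mean of the remaining population by a multiple of
  \<open>f x - \<mu>\<close>; altogether \<open>f x - \<mu>\<close> is only contracted, by the factor \<open>1 - m / (N - 1)\<close>.\<close>

lemma sampling_mgf_bound: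
  fixes f :: "'a \<Rightarrow> real"
  assumes "finite S" "m \<le> card S" "\<And>x. x \<in> S \<Longrightarrow> f x \<in> {a..b}" "l \<ge> 0"
  shows "(\<Sum>D\<in>subsets_of_size S m. exp (l * ((\<Sum>x\<in>D. f x) - m * avg S f)))
    \<le> (card S choose m) * exp (m * (l\<^sup>2 * (b - a)\<^sup>2 / 8))"
  using assms(1-3)
proof (induction m arbitrary: S)
  case 0
  have "subsets_of_size S 0 = {{}}"
    using 0 by (auto dest: finite_subset)
  then show ?case by simp
next
  case (Suc m)
  define N where "N = card S"
  define c where "c = l\<^sup>2 * (b - a)\<^sup>2 / 8"
  \<comment> \<open>For \<open>N = 1\<close> the division by zero yields 0, so \<open>t = 1\<close>;
    this is consistent because then \<open>m = 0\<close>.\<close>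
  define t where "t = 1 - real m / (real N - 1)"
  define \<mu> where "\<mu> = avg S f"
  have N: "Suc m \<le> N" "N \<ge> 1" and ne: "S \<noteq> {}" using Suc by (auto simp: N_def)
  have t: "0 \<le> t" "t \<le> 1"
    using N by (cases "N = 1"; auto simp: t_def field_simps)+
  have split: "(\<Sum>y\<in>insert x D. f y) - real (Suc m) * \<mu> =
      t * (f x - \<mu>) + ((\<Sum>y\<in>D. f y) - m * avg (S - {x}) f)"
    if x: "x \<in> S" and D: "D \<in> subsets_of_size (S - {x}) m" for x D
  proof -
    have fin: "finite D" using D Suc.prems finite_subset by fastforce
    have xD: "x \<notin> D" using D by auto
    have sS: "sum f S = N * \<mu>" using N by (simp add: \<mu>_def N_def)
    have "sum f (S - {x}) = N * \<mu> - f x"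
      using x Suc.prems by (simp add: sum_diff1 sS)
    moreover have "real (card (S - {x})) = real N - 1"
      using x Suc.prems N by (simp add: N_def of_nat_diff)
    ultimately have av: "avg (S - {x}) f = (N * \<mu> - f x) / (real N - 1)" by simp
    show ?thesis
    proof (cases "N = 1")
      case True
      then have "m = 0" using N by simp
      then show ?thesis using fin xD D True by (simp add: t_def)
    next
      case False
      then have nz: "real N - 1 \<noteq> 0" using N by simp
      \<comment> \<open>Removing \<open>x\<close> shifts the mean by \<open>- z\<close>. Over the
        \<open>m\<close> remaining draws this amounts to \<open>m * z\<close>, which is taken off
        \<open>f x - \<mu>\<close> and leaves the factor \<open>t\<close>.\<close>
      define z where "z = (f x - \<mu>) / (real N - 1)"
      have a1: "(N * \<mu> - f x) / (real N - 1) = \<mu> - z"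
        using nz by (simp add: z_def field_simps)
      have a2: "t * (f x - \<mu>) = f x - \<mu> - m * z"
        by (simp add: z_def t_def algebra_simps)
      show ?thesis unfolding av a1 a2 sum.insert[OF fin xD] by (simp add: algebra_simps)
    qed
  qed
  have "real (Suc m) * (\<Sum>D\<in>subsets_of_size S (Suc m). exp (l * ((\<Sum>x\<in>D. f x) - Suc m * \<mu>)))
      = (\<Sum>x\<in>S. \<Sum>D\<in>subsets_of_size (S - {x}) m.
          exp (l * ((\<Sum>y\<in>insert x D. f y) - real (Suc m) * \<mu>)))"
    by (rule sum_subsets_of_size_Suc) fact
  also have "\<dots> = (\<Sum>x\<in>S. exp (l * t * (f x - \<mu>)) * (\<Sum>D\<in>subsets_of_size (S - {x}) m.
          exp (l * ((\<Sum>y\<in>D. f y) - m * avg (S - {x}) f))))"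
    unfolding sum_distrib_left by (intro sum.cong refl) (simp only: split distrib_left exp_add mult.assoc)
  also have "\<dots> \<le> (\<Sum>x\<in>S. exp (l * t * (f x - \<mu>)) * ((N - 1 choose m) * exp (m * c)))"
  proof (intro sum_mono mult_left_mono)
    fix x assume x: "x \<in> S"
    have "card (S - {x}) = N - 1" using x Suc.prems by (simp add: N_def)
    with Suc.IH[of "S - {x}"] Suc.prems N
    show "(\<Sum>D\<in>subsets_of_size (S - {x}) m. exp (l * ((\<Sum>y\<in>D. f y) - m * avg (S - {x}) f)))
        \<le> (N - 1 choose m) * exp (m * c)"
      by (simp add: c_def)
  qed simp
  also have "\<dots> = (\<Sum>x\<in>S. exp (l * t * (f x - \<mu>))) * ((N - 1 choose m) * exp (m * c))"
    by (simp add: sum_distrib_right)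
  also have "\<dots> \<le> (N * exp c) * ((N - 1 choose m) * exp (m * c))"
  proof (intro mult_right_mono)
    have "(\<Sum>x\<in>S. exp (l * t * (f x - \<mu>))) \<le> N * exp ((l * t)\<^sup>2 * (b - a)\<^sup>2 / 8)"
      unfolding \<mu>_def N_def
      by (rule Hoeffdings_lemma_finite) (use Suc.prems assms(4) t ne in auto)
    also have "(l * t)\<^sup>2 * (b - a)\<^sup>2 / 8 \<le> c"
      using t by (simp add: c_def power_mult_distrib mult_right_mono mult_left_le power_le_one)
    finally show "(\<Sum>x\<in>S. exp (l * t * (f x - \<mu>))) \<le> N * exp c"
      by (simp add: mult_left_mono)
  qed simp
  also have "\<dots> = real (N * (N - 1 choose m)) * exp (Suc m * c)"
    by (simp add: algebra_simps exp_add)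
  also have "N * (N - 1 choose m) = Suc m * (N choose Suc m)"
    using times_binomial_minus1_eq[of "Suc m" N] by simp
  finally have "real (Suc m) * (\<Sum>D\<in>subsets_of_size S (Suc m). exp (l * ((\<Sum>x\<in>D. f x) - Suc m * \<mu>)))
      \<le> real (Suc m) * ((N choose Suc m) * exp (Suc m * c))"
    by (simp only: of_nat_mult mult.assoc)
  then show ?case
    unfolding \<mu>_def N_def c_def by (simp only: mult_le_cancel_left_pos of_nat_0_less_iff zero_less_Suc)
qed

text \<open>Chernoff's method. Only the oscillation of \<open>f\<close> is bounded, because a cover
  of functions up to additive constants controls nothing else.\<close>

lemma sampling_upper_tail:
  fixes f :: "'a \<Rightarrow> real"
  assumes "finite S" "m \<le> card S" "m > 0" "w > 0" "t > 0"
    and osc: "\<And>x y. x \<in> S \<Longrightarrow> y \<in> S \<Longrightarrow> f x - f y \<le> w"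
  shows "card {D \<in> subsets_of_size S m. avg D f - avg S f > t}
    \<le> (card S choose m) * exp (- 2 * real m * t\<^sup>2 / w\<^sup>2)"
proof -
  define a where "a = Min (f ` S)"
  have ne: "S \<noteq> {}" using assms by auto
  have "a \<in> f ` S" unfolding a_def using assms ne by (intro Min_in) auto
  then obtain z where z: "z \<in> S" "a = f z" by blast
  have rng: "f x \<in> {a..a + w}" if "x \<in> S" for x
  proof -
    have "a \<le> f x" unfolding a_def using assms that by (intro Min_le) auto
    then show ?thesis using osc[OF that z(1)] z by auto
  qed
  \<comment> \<open>This value minimises the final exponent
    \<open>m * (l^2 * w^2 / 8) - l * (m * t)\<close>.\<close>
  define l where "l = 4 * t / w\<^sup>2"
  have l: "l > 0" using assms by (simp add: l_def)
  let ?B = "{D \<in> subsets_of_size S m. avg D f - avg S f > t}"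
  have "card ?B * exp (l * (m * t)) = (\<Sum>D\<in>?B. exp (l * (m * t)))" by simp
  also have "\<dots> \<le> (\<Sum>D\<in>?B. exp (l * ((\<Sum>x\<in>D. f x) - m * avg S f)))"
  proof (intro sum_mono)
    fix D assume D: "D \<in> ?B"
    have "m * t \<le> (\<Sum>x\<in>D. f x) - m * avg S f"
      using D \<open>m > 0\<close> by (auto simp: field_simps)
    then show "exp (l * (m * t)) \<le> exp (l * ((\<Sum>x\<in>D. f x) - m * avg S f))"
      using l by (simp only: exp_le_cancel_iff mult_left_mono less_imp_le)
  qed
  also have "\<dots> \<le> (\<Sum>D\<in>subsets_of_size S m. exp (l * ((\<Sum>x\<in>D. f x) - m * avg S f)))"
    using assms by (intro sum_mono2) auto
  also have "\<dots> \<le> (card S choose m) * exp (m * (l\<^sup>2 * ((a + w) - a)\<^sup>2 / 8))"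
    using assms rng l by (intro sampling_mgf_bound) auto
  finally have "card ?B \<le> (card S choose m) * exp (m * (l\<^sup>2 * w\<^sup>2 / 8)) / exp (l * (m * t))"
    by (simp add: field_simps)
  also have "\<dots> = (card S choose m) * exp (m * (l\<^sup>2 * w\<^sup>2 / 8) - l * (m * t))"
    by (simp add: exp_diff)
  also have "m * (l\<^sup>2 * w\<^sup>2 / 8) - l * (m * t) = - 2 * real m * t\<^sup>2 / w\<^sup>2"
    using assms by (simp add: l_def power2_eq_square field_simps)
  finally show ?thesis .
qed

lemma sampling_tail:
  fixes f :: "'a \<Rightarrow> real"
  assumes "finite S" "m \<le> card S" "m > 0" "w > 0" "t > 0"
    and osc: "\<And>x y. x \<in> S \<Longrightarrow> y \<in> S \<Longrightarrow> f x - f y \<le> w"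
  shows "card {D \<in> subsets_of_size S m. \<bar>avg S f - avg D f\<bar> > t}
    \<le> 2 * (card S choose m) * exp (- 2 * real m * t\<^sup>2 / w\<^sup>2)"
proof -
  let ?B = "\<lambda>f. {D \<in> subsets_of_size S m. avg D f - avg S f > t}"
  have "{D \<in> subsets_of_size S m. \<bar>avg S f - avg D f\<bar> > t} \<subseteq> ?B f \<union> ?B (\<lambda>x. - f x)"
    by (auto simp: sum_negf abs_real_def split: if_splits)
  then have "card {D \<in> subsets_of_size S m. \<bar>avg S f - avg D f\<bar> > t} \<le> card (?B f \<union> ?B (\<lambda>x. - f x))"
    using assms by (intro card_mono) auto
  also have "\<dots> \<le> card (?B f) + card (?B (\<lambda>x. - f x))" by (rule card_Un_le)
  finally have *: "real (card {D \<in> subsets_of_size S m. \<bar>avg S f - avg D f\<bar> > t})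
    \<le> real (card (?B f)) + real (card (?B (\<lambda>x. - f x)))" by linarith
  have "card (?B f) \<le> (card S choose m) * exp (- 2 * real m * t\<^sup>2 / w\<^sup>2)"
    by (rule sampling_upper_tail) (use assms in auto)
  moreover have "card (?B (\<lambda>x. - f x)) \<le> (card S choose m) * exp (- 2 * real m * t\<^sup>2 / w\<^sup>2)"
    by (rule sampling_upper_tail) (use assms in auto)
  ultimately show ?thesis using * by simp
qed

section \<open>Duality for transportation problems\<close>

text \<open>\<open>G\<close> below is the dual objective with the minimum softened at inverse temperature \<open>\<beta>\<close>. It attains
  its maximum, and stationarity there says that the Gibbs assignment meets the capacities \<open>\<Gamma>\<close>.\<close>

locale soft_transport =
  fixes Q :: "'a set" and w :: "'a \<Rightarrow> real" and C :: "'b set" and \<Gamma> :: "'b \<Rightarrow> real"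
    and dst :: "'a \<Rightarrow> 'b \<Rightarrow> real" and \<beta> :: real
  assumes fin: "finite Q" "finite C" and ne: "C \<noteq> {}"
    and w: "\<And>x. x \<in> Q \<Longrightarrow> 0 \<le> w x" and \<Gamma>: "\<And>u. u \<in> C \<Longrightarrow> 0 < \<Gamma> u"
    and bal: "(\<Sum>u\<in>C. \<Gamma> u) = (\<Sum>x\<in>Q. w x)"
    and \<beta>: "\<beta> > 0"
begin

text \<open>The partition function of the Gibbs assignment: \<open>- (ln (Z g x) / \<beta>)\<close>
  is the soft minimum of \<open>dst x u - g u\<close> over \<open>u\<close>.\<close>

definition Z :: "('b \<Rightarrow> real) \<Rightarrow> 'a \<Rightarrow> real" where
  "Z g x = (\<Sum>u\<in>C. exp (\<beta> * (g u - dst x u)))"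

definition G :: "('b \<Rightarrow> real) \<Rightarrow> real" where
  "G g = (\<Sum>u\<in>C. \<Gamma> u * g u) - (\<Sum>x\<in>Q. w x * (ln (Z g x) / \<beta>))"

lemma Z_pos: "Z g x > 0"
  unfolding Z_def using fin ne by (intro sum_pos) auto

lemma Z_ge: "u \<in> C \<Longrightarrow> exp (\<beta> * (g u - dst x u)) \<le> Z g x"
  unfolding Z_def using fin by (intro member_le_sum) auto

lemma ln_Z_ge: "u \<in> C \<Longrightarrow> g u - dst x u \<le> ln (Z g x) / \<beta>"
  using Z_ge[of u g x] Z_pos[of g x] \<beta> by (simp add: ln_ge_iff pos_le_divide_eq mult.commute)

lemma Z_shift: "Z (\<lambda>u. g u + t) x = exp (\<beta> * t) * Z g x"
  unfolding Z_def sum_distrib_left by (intro sum.cong refl) (simp add: algebra_simps flip: exp_add)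

text \<open>The total capacity equals the total weight, so a constant added to all prices cancels.
  This allows the largest price to be normalised to 0.\<close>

lemma G_shift: "G (\<lambda>u. g u + t) = G g"
proof -
  have "ln (Z (\<lambda>u. g u + t) x) / \<beta> = t + ln (Z g x) / \<beta>" for x
    using Z_pos[of g x] \<beta> by (simp add: Z_shift ln_mult add_divide_distrib)
  then show ?thesis
    by (simp add: G_def distrib_left sum.distrib bal flip: sum_distrib_right)
qed

lemma continuous_G: "continuous_on S G"
proof -
  have nz: "Z g x \<noteq> 0" for g x using Z_pos[of g x] by simp
  have co: "continuous_on S (\<lambda>g. g u)" for u :: 'b
    by (rule continuous_on_subset[OF continuous_on_product_coordinates]) simp
  have "continuous_on S (\<lambda>g. Z g x)" for x
    unfolding Z_def[abs_def] by (intro continuous_intros co)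
  then show ?thesis
    unfolding G_def[abs_def] using \<beta> nz by (intro continuous_intros co) auto
qed

text \<open>Capacities are at least some \<open>\<gamma> > 0\<close>, so a price lying
  \<open>M\<close> below the largest one costs at least \<open>\<gamma> * M\<close>, while the rest
  of the objective is bounded by \<open>c\<close>.\<close>

lemma G_coercive:
  obtains M where "M > 0" "\<And>g u v. u \<in> C \<Longrightarrow> v \<in> C \<Longrightarrow> (\<And>a. a \<in> C \<Longrightarrow> g a \<le> g v) \<Longrightarrow>
    g v - g u \<ge> M \<Longrightarrow> G g < G (\<lambda>_. 0)"
proof -
  define c where "c = (\<Sum>x\<in>Q. w x * (\<Sum>u\<in>C. \<bar>dst x u\<bar>))"
  define \<gamma> where "\<gamma> = Min (\<Gamma> ` C)"
  have \<gamma>: "\<gamma> > 0" "\<And>u. u \<in> C \<Longrightarrow> \<gamma> \<le> \<Gamma> u"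
    using fin ne \<Gamma> by (auto simp: \<gamma>_def)
  define M where "M = (\<bar>c - G (\<lambda>_. 0)\<bar> + 1) / \<gamma>"
  have "G g < G (\<lambda>_. 0)"
    if uv: "u \<in> C" "v \<in> C" and mx: "\<And>a. a \<in> C \<Longrightarrow> g a \<le> g v" and far: "g v - g u \<ge> M" for g u v
  proof -
    have "(\<Sum>x\<in>Q. w x * (g v - (\<Sum>u\<in>C. \<bar>dst x u\<bar>))) \<le> (\<Sum>x\<in>Q. w x * (ln (Z g x) / \<beta>))"
    proof (intro sum_mono mult_left_mono w)
      fix x
      have "dst x v \<le> (\<Sum>u\<in>C. \<bar>dst x u\<bar>)"
        using member_le_sum[of v C "\<lambda>u. \<bar>dst x u\<bar>"] fin uv by force
      then show "g v - (\<Sum>u\<in>C. \<bar>dst x u\<bar>) \<le> ln (Z g x) / \<beta>"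
        using ln_Z_ge[OF uv(2), of g x] by linarith
    qed
    then have "(\<Sum>u\<in>C. \<Gamma> u) * g v - c \<le> (\<Sum>x\<in>Q. w x * (ln (Z g x) / \<beta>))"
      by (simp add: bal c_def right_diff_distrib sum_subtractf sum_distrib_right)
    then have "G g \<le> c - (\<Sum>a\<in>C. \<Gamma> a * (g v - g a))"
      unfolding G_def by (simp add: right_diff_distrib sum_subtractf sum_distrib_right)
    moreover have "\<Gamma> u * (g v - g u) \<le> (\<Sum>a\<in>C. \<Gamma> a * (g v - g a))"
      using fin uv mx \<Gamma> by (intro member_le_sum) (auto simp: less_imp_le)
    moreover have "\<gamma> * M \<le> \<Gamma> u * (g v - g u)"
      using \<gamma> \<Gamma>[OF uv(1)] uv far by (intro mult_mono) (auto simp: M_def)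
    moreover have "\<gamma> * M = \<bar>c - G (\<lambda>_. 0)\<bar> + 1" using \<gamma> by (simp add: M_def)
    ultimately show ?thesis by linarith
  qed
  moreover have "M > 0" using \<gamma> by (simp add: M_def add_nonneg_pos)
  ultimately show ?thesis using that by blast
qed

text \<open>Shift invariance and coercivity confine the search to prices in \<open>{-M..0}\<close>.
  Values outside \<open>C\<close> do not affect \<open>G\<close> and are set to 0, so the cube over
  the whole type serves; it is compact by Tychonoff.\<close>

lemma G_attains_max: "\<exists>g. \<forall>h. G h \<le> G g"
proof -
  obtain M where M: "M > 0" "\<And>g u v. u \<in> C \<Longrightarrow> v \<in> C \<Longrightarrow> (\<And>a. a \<in> C \<Longrightarrow> g a \<le> g v) \<Longrightarrow>
    g v - g u \<ge> M \<Longrightarrow> G g < G (\<lambda>_. 0)"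
    using G_coercive by metis
  define B where "B = Pi\<^sub>E UNIV (\<lambda>u::'b. {-M..0})"
  have cB: "compact B"
    using compactin_PiE[of "\<lambda>_. euclideanreal" UNIV "\<lambda>u::'b. {-M..0}"]
    by (simp add: B_def euclidean_product_topology compactin_euclidean_iff)
  have zB: "(\<lambda>_. 0) \<in> B" using M by (auto simp: B_def)
  obtain g where g: "g \<in> B" "\<And>h. h \<in> B \<Longrightarrow> G h \<le> G g"
    using continuous_attains_sup[OF cB _ continuous_G] zB by blast
  have "G h \<le> G g" for h
  proof -
    have "Max (h ` C) \<in> h ` C" using fin ne by (intro Max_in) auto
    then obtain v where v: "v \<in> C" "h v = Max (h ` C)" by force
    then have vmax: "h a \<le> h v" if "a \<in> C" for a
      using fin that by simp
    show ?thesis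
    proof (cases "\<exists>u\<in>C. h v - h u \<ge> M")
      case True
      then have "G h < G (\<lambda>_. 0)" using M(2) v vmax by blast
      then show ?thesis using g(2)[OF zB] by linarith
    next
      case False
      define h' where "h' = (\<lambda>u. if u \<in> C then h u + - h v else 0)"
      have "h' \<in> B" using False vmax M by (force simp: h'_def B_def)
      moreover have "G h' = G (\<lambda>u. h u + - h v)"
        unfolding G_def Z_def h'_def by (simp cong: sum.cong)
      ultimately show ?thesis using g(2)[of h'] G_shift[of h "- h v"] by simp
    qed
  qed
  then show ?thesis by blast
qed

lemma stationary:
  assumes g: "\<And>h. G h \<le> G g" and u: "u \<in> C"
  shows "(\<Sum>x\<in>Q. w x * (exp (\<beta> * (g u - dst x u)) / Z g x)) = \<Gamma> u"
proof -
  define f where "f t = G (g(u := g u + t))" for t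
  \<comment> \<open>The coordinate \<open>u\<close> is split off, so that only one exponential
    inside each logarithm depends on \<open>t\<close>.\<close>
  have f: "f t = \<Gamma> u * (g u + t) + (\<Sum>v\<in>C - {u}. \<Gamma> v * g v) -
      (\<Sum>x\<in>Q. w x * (ln (exp (\<beta> * (g u + t - dst x u)) + (\<Sum>v\<in>C - {u}. exp (\<beta> * (g v - dst x v)))) / \<beta>))" for t
    unfolding f_def G_def Z_def using fin u
    by (simp add: sum.remove[of C u] cong: sum.cong_simp)
  have der: "((\<lambda>t. ln (exp (\<beta> * (g u + t - dst x u)) + (\<Sum>v\<in>C - {u}. exp (\<beta> * (g v - dst x v)))) / \<beta>)
      has_real_derivative exp (\<beta> * (g u - dst x u)) / Z g x) (at 0)" for x
  proof -
    define s where "s = (\<Sum>v\<in>C - {u}. exp (\<beta> * (g v - dst x v)))"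
    have "exp (\<beta> * (g u - dst x u)) + s = Z g x"
      unfolding Z_def s_def using fin u by (simp add: sum.remove[of C u])
    then show ?thesis
      unfolding s_def[symmetric] using Z_pos[of g x] \<beta>
      by (auto intro!: derivative_eq_intros)
  qed
  have "(f has_real_derivative
      \<Gamma> u - (\<Sum>x\<in>Q. w x * (exp (\<beta> * (g u - dst x u)) / Z g x))) (at 0)"
    unfolding f[abs_def]
    by (rule DERIV_diff[OF _ DERIV_sum[OF DERIV_cmult[OF der]]]) (auto intro!: derivative_eq_intros)
  then have "\<Gamma> u - (\<Sum>x\<in>Q. w x * (exp (\<beta> * (g u - dst x u)) / Z g x)) = 0"
    by (rule DERIV_local_max[where d = 1]) (use g in \<open>auto simp: f_def\<close>)
  then show ?thesis by simp
qed

text \<open>The Gibbs assignment at the maximiser is feasible by stationarity. Its value exceeds the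
  dual value by at most the entropy over \<open>\<beta>\<close>, which vanishes as
  \<open>\<beta>\<close> grows.\<close>

lemma approx_duality:
  obtains \<sigma> g where
    "\<And>x u. x \<in> Q \<Longrightarrow> 0 \<le> \<sigma> x u" "\<And>x. (\<Sum>u\<in>C. \<sigma> x u) = w x" "\<And>u. u \<in> C \<Longrightarrow> (\<Sum>x\<in>Q. \<sigma> x u) = \<Gamma> u"
    "(\<Sum>x\<in>Q. \<Sum>u\<in>C. \<sigma> x u * dst x u) \<le>
      (\<Sum>x\<in>Q. w x * (MIN u\<in>C. dst x u - g u)) + (\<Sum>u\<in>C. \<Gamma> u * g u) + (\<Sum>x\<in>Q. w x) * card C / \<beta>"
proof -
  obtain g where g: "\<And>h. G h \<le> G g" using G_attains_max by blast
  define p where "p x u = exp (\<beta> * (g u - dst x u)) / Z g x" for x u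
  define \<sigma> where "\<sigma> x u = w x * p x u" for x u
  have p0: "p x u > 0" for x u using Z_pos[of g x] by (simp add: p_def)
  have p1: "(\<Sum>u\<in>C. p x u) = 1" for x
    using Z_pos[of g x] by (simp add: p_def Z_def flip: sum_divide_distrib)
  have row: "(\<Sum>u\<in>C. \<sigma> x u) = w x" for x
    by (simp add: \<sigma>_def p1 flip: sum_distrib_left)
  have col: "(\<Sum>x\<in>Q. \<sigma> x u) = \<Gamma> u" if "u \<in> C" for u
    unfolding \<sigma>_def p_def by (rule stationary) fact+
  \<comment> \<open>A crude bound of 1 on the entropy contribution of each centre is enough, since
    \<open>\<beta>\<close> can be chosen freely later.\<close>
  have ent: "- (q * ln q) \<le> 1" if "q > 0" for q :: real
  proof -
    have "- ln q \<le> 1 / q - 1" using ln_le_minus_one[of "1 / q"] that by (simp add: ln_div)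
    then have "q * (- ln q) \<le> q * (1 / q - 1)" using that by (intro mult_left_mono) auto
    also have "\<dots> = 1 - q" using that by (simp add: right_diff_distrib)
    finally show ?thesis using that by simp
  qed
  have pt: "(\<Sum>u\<in>C. p x u * (dst x u - g u)) \<le> (MIN u\<in>C. dst x u - g u) + card C / \<beta>" for x
  proof -
    have "dst x u - g u = - (ln (p x u) / \<beta>) - ln (Z g x) / \<beta>" for u
      using Z_pos[of g x] \<beta> by (simp add: p_def ln_div field_simps)
    then have "(\<Sum>u\<in>C. p x u * (dst x u - g u)) =
        (\<Sum>u\<in>C. - (p x u * ln (p x u)) / \<beta> - p x u * (ln (Z g x) / \<beta>))"
      by (intro sum.cong refl) (simp only: right_diff_distrib, simp)
    also have "\<dots> = (\<Sum>u\<in>C. - (p x u * ln (p x u))) / \<beta> - ln (Z g x) / \<beta>"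
      by (simp only: sum_subtractf flip: sum_divide_distrib sum_distrib_right) (simp add: p1)
    finally have "(\<Sum>u\<in>C. p x u * (dst x u - g u)) =
        (\<Sum>u\<in>C. - (p x u * ln (p x u))) / \<beta> - ln (Z g x) / \<beta>" .
    moreover have "(\<Sum>u\<in>C. - (p x u * ln (p x u))) / \<beta> \<le> (\<Sum>u\<in>C. 1) / \<beta>"
      using \<beta> p0 ent by (intro divide_right_mono sum_mono) auto
    moreover have "- (ln (Z g x) / \<beta>) \<le> (MIN u\<in>C. dst x u - g u)"
      using fin ne ln_Z_ge[of _ g x] by (subst Min_ge_iff) (auto simp: algebra_simps)
    ultimately show ?thesis by simp
  qed
  have "(\<Sum>x\<in>Q. \<Sum>u\<in>C. \<sigma> x u * dst x u) = (\<Sum>x\<in>Q. \<Sum>u\<in>C. \<sigma> x u * (dst x u - g u)) + (\<Sum>x\<in>Q. \<Sum>u\<in>C. \<sigma> x u * g u)"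
    by (simp add: algebra_simps flip: sum.distrib)
  also have "(\<Sum>x\<in>Q. \<Sum>u\<in>C. \<sigma> x u * g u) = (\<Sum>u\<in>C. \<Gamma> u * g u)"
    by (subst sum.swap) (simp add: col flip: sum_distrib_right)
  also have "(\<Sum>x\<in>Q. \<Sum>u\<in>C. \<sigma> x u * (dst x u - g u)) = (\<Sum>x\<in>Q. w x * (\<Sum>u\<in>C. p x u * (dst x u - g u)))"
    by (simp add: \<sigma>_def sum_distrib_left mult.assoc)
  also have "\<dots> \<le> (\<Sum>x\<in>Q. w x * ((MIN u\<in>C. dst x u - g u) + card C / \<beta>))"
    by (intro sum_mono mult_left_mono pt w)
  also have "\<dots> = (\<Sum>x\<in>Q. w x * (MIN u\<in>C. dst x u - g u)) + (\<Sum>x\<in>Q. w x) * card C / \<beta>"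
    by (simp add: distrib_left sum.distrib sum_distrib_right sum_divide_distrib)
  finally have "(\<Sum>x\<in>Q. \<Sum>u\<in>C. \<sigma> x u * dst x u) \<le>
      (\<Sum>x\<in>Q. w x * (MIN u\<in>C. dst x u - g u)) + (\<Sum>u\<in>C. \<Gamma> u * g u) + (\<Sum>x\<in>Q. w x) * card C / \<beta>"
    by linarith
  then show ?thesis using row col p0 w by (intro that[of \<sigma> g]) (auto simp: \<sigma>_def less_imp_le)
qed

end

section \<open>A dimension-free cover of the clustering functions\<close>

definition ip :: "nat \<Rightarrow> pt \<Rightarrow> pt \<Rightarrow> real" where
  "ip d x y = (\<Sum>i<d. x i * y i)"

text \<open>The perceptron state after the updates in \<open>l\<close>: \<open>e\<close> is the step
  length, and each entry is a sign with an update vector.\<close>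

definition signed_comb :: "real \<Rightarrow> (real \<times> pt) list \<Rightarrow> pt" where
  "signed_comb e l = (\<lambda>i. e * (\<Sum>(s, y)\<leftarrow>l. s * y i))"

section \<open>Inner products and Euclidean distances on the first \<open>d\<close>
  coordinates\<close>

lemma ip_nonneg: "0 \<le> ip d x x"
  unfolding ip_def by (intro sum_nonneg) simp

lemma ip_Cauchy_Schwarz: "(ip d x y)\<^sup>2 \<le> ip d x x * ip d y y"
  using Cauchy_Schwarz_ineq_sum[of x y "{..<d}"] by (simp add: ip_def power2_eq_square)

lemma ip_commute: "ip d x y = ip d y x"
  by (simp add: ip_def mult.commute)

lemma ip_diff_scaled:
  "ip d (\<lambda>i. v i - a * y i) (\<lambda>i. v i - a * y i) = ip d v v - 2 * a * ip d y v + a\<^sup>2 * ip d y y"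
  unfolding ip_def sum_distrib_left sum_subtractf[symmetric] sum.distrib[symmetric]
  by (intro sum.cong refl) (simp add: algebra_simps power2_eq_square)

lemma edist_nonneg: "0 \<le> edist d x y"
  by (simp add: edist_def)

lemma edist_square: "(edist d x y)\<^sup>2 = ip d (\<lambda>i. x i - y i) (\<lambda>i. x i - y i)"
  by (simp add: edist_def L2_set_def ip_def power2_eq_square sum_nonneg)

lemma edist_commute: "edist d x y = edist d y x"
  by (simp add: edist_def L2_set_def power2_commute)

lemma edist_triangle: "edist d x z \<le> edist d x y + edist d y z"
  using L2_set_triangle_ineq[of "\<lambda>i. x i - y i" "\<lambda>i. y i - z i" "{..<d}"] by (simp add: edist_def)

text \<open>The mistake bound of the perceptron: while some \<open>y\<close> violates the claim, adding \<open>\<plusminus>e y\<close> to the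
  combination decreases the squared norm of the residual by at least \<open>e\<^sup>2\<close>. The zero vector pads
  the list to its full length.\<close>

lemma perceptron_approximation:
  assumes zero: "(\<lambda>_. 0) \<in> Y" and Y: "\<And>y. y \<in> Y \<Longrightarrow> ip d y y \<le> 1" and w: "ip d w w \<le> 1"
    and e: "e > 0" "real A * e\<^sup>2 \<ge> 1"
  obtains l where "set l \<subseteq> {-1, 1} \<times> Y" "length l = A"
    "\<And>y. y \<in> Y \<Longrightarrow> \<bar>ip d y (\<lambda>i. w i - signed_comb e l i)\<bar> \<le> e"
proof -
  define res where "res l = (\<lambda>i. w i - signed_comb e l i)" for l
  have res_Cons: "res ((s, y) # l) = (\<lambda>i. res l i - e * s * y i)" for s y l
    by (auto simp: res_def signed_comb_def algebra_simps)
  have "\<exists>l. set l \<subseteq> {-1, 1} \<times> Y \<and> length l = j \<and>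
      ((\<forall>y\<in>Y. \<bar>ip d y (res l)\<bar> \<le> e) \<or> ip d (res l) (res l) \<le> 1 - j * e\<^sup>2)" for j
  proof (induction j)
    case 0
    show ?case using w by (intro exI[of _ "[]"]) (simp add: res_def signed_comb_def)
  next
    case (Suc j)
    then obtain l where l: "set l \<subseteq> {-1, 1} \<times> Y" "length l = j"
      "(\<forall>y\<in>Y. \<bar>ip d y (res l)\<bar> \<le> e) \<or> ip d (res l) (res l) \<le> 1 - j * e\<^sup>2" by blast
    show ?case
    proof (cases "\<forall>y\<in>Y. \<bar>ip d y (res l)\<bar> \<le> e")
      case True
      then show ?thesis using l zero
        by (intro exI[of _ "(1, \<lambda>_. 0) # l"]) (simp add: res_Cons)
    next
      case False
      then obtain y where y: "y \<in> Y" "\<bar>ip d y (res l)\<bar> > e" by force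
      define s where "s = (if ip d y (res l) > 0 then 1 else - 1 :: real)"
      have s: "s * ip d y (res l) = \<bar>ip d y (res l)\<bar>" "s\<^sup>2 = 1" "s \<in> {-1, 1}"
        by (auto simp: s_def)
      have "ip d (res ((s, y) # l)) (res ((s, y) # l))
          = ip d (res l) (res l) - 2 * e * (s * ip d y (res l)) + e\<^sup>2 * s\<^sup>2 * ip d y y"
        by (simp add: res_Cons ip_diff_scaled power_mult_distrib)
      also have "\<dots> \<le> (1 - j * e\<^sup>2) - 2 * e * e + e\<^sup>2 * 1"
        unfolding s using l False Y[OF y(1)] y e
        by (intro add_mono diff_mono mult_mono) (auto simp: ip_nonneg)
      also have "\<dots> = 1 - Suc j * e\<^sup>2" by (simp add: algebra_simps power2_eq_square)
      finally show ?thesis using l y s by (intro exI[of _ "(s, y) # l"]) auto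
    qed
  qed
  then obtain l where l: "set l \<subseteq> {-1, 1} \<times> Y" "length l = A"
    "(\<forall>y\<in>Y. \<bar>ip d y (res l)\<bar> \<le> e) \<or> ip d (res l) (res l) \<le> 1 - A * e\<^sup>2" by blast
  have "\<bar>ip d y (res l)\<bar> \<le> e" if "y \<in> Y" for y
  proof (cases "\<forall>y\<in>Y. \<bar>ip d y (res l)\<bar> \<le> e")
    \<comment> \<open>After \<open>A\<close> mistakes the squared norm of the residual has dropped
      to 0, so every inner product with it vanishes.\<close>
    case False
    then have "ip d (res l) (res l) \<le> 1 - A * e\<^sup>2" using l by blast
    then have "ip d (res l) (res l) = 0" using e ip_nonneg[of d "res l"] by linarith
    then have "(ip d y (res l))\<^sup>2 \<le> 0" using ip_Cauchy_Schwarz[of d y "res l"] by simp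
    then show ?thesis using e by simp
  qed (use that in blast)
  then show ?thesis using that l unfolding res_def by blast
qed

text \<open>The squares differ by \<open>2 * s * (\<beta> - \<alpha>)\<close>; dividing by
  \<open>a + b\<close>, which is at least \<open>s\<close>, removes the factor \<open>s\<close>.
  Clamping at 0 is harmless because \<open>a\<close> squared is nonnegative.\<close>

lemma abs_sqrt_diff_le:
  fixes a s \<alpha> \<beta> q e :: real
  assumes "0 \<le> s" "s \<le> a" "a\<^sup>2 = q - 2 * s * \<alpha> + s\<^sup>2" "\<bar>\<alpha> - \<beta>\<bar> \<le> e" "0 \<le> e"
  shows "\<bar>a - sqrt (max 0 (q - 2 * s * \<beta> + s\<^sup>2))\<bar> \<le> 2 * e"
proof -
  define z where "z = q - 2 * s * \<beta> + s\<^sup>2"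
  define b where "b = sqrt (max 0 z)"
  have b: "b \<ge> 0" "b\<^sup>2 = max 0 z" by (auto simp: b_def)
  have "\<bar>a - b\<bar> * (a + b) = \<bar>a\<^sup>2 - b\<^sup>2\<bar>"
    unfolding power2_eq_square square_diff_square_factored abs_mult using assms b by simp
  also have "\<dots> \<le> \<bar>a\<^sup>2 - z\<bar>" unfolding b(2) by (auto simp: max_def)
  also have "\<dots> = 2 * s * \<bar>\<alpha> - \<beta>\<bar>"
  proof -
    have "a\<^sup>2 - z = 2 * s * (\<beta> - \<alpha>)" unfolding assms(3) z_def by (simp add: algebra_simps)
    then show ?thesis using assms by (simp add: abs_mult abs_minus_commute)
  qed
  also have "\<dots> \<le> 2 * a * e" using assms by (intro mult_mono) auto
  finally have *: "\<bar>a - b\<bar> * (a + b) \<le> 2 * e * a" by (simp add: mult_ac)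
  show ?thesis
  proof (cases "a = 0")
    case True
    then have "s = 0" "q = 0" using assms by auto
    then show ?thesis using True assms by simp
  next
    case False
    then have "a > 0" using assms by simp
    have "\<bar>a - b\<bar> * a \<le> \<bar>a - b\<bar> * (a + b)" using b by (intro mult_left_mono) auto
    with * have "\<bar>a - b\<bar> * a \<le> 2 * e * a" by linarith
    then show ?thesis using \<open>a > 0\<close> by (simp add: b_def z_def)
  qed
qed

text \<open>\<open>ray_dist q \<alpha> s\<close> is the distance between \<open>y\<close> and \<open>s w\<close>, for \<open>q = \<parallel>y\<parallel>\<^sup>2\<close>,
  \<open>\<alpha> = \<langle>y, w\<rangle>\<close> and a unit vector \<open>w\<close>.\<close>

definition ray_dist :: "real \<Rightarrow> real \<Rightarrow> real \<Rightarrow> real" where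
  "ray_dist q \<alpha> s = sqrt (q - 2 * s * \<alpha> + s\<^sup>2)"

section \<open>Distance from a fixed point to a point moving along a ray\<close>

context
  fixes q \<alpha> R :: real
  assumes q: "\<alpha>\<^sup>2 \<le> q" "q \<le> R\<^sup>2" "R > 0"
begin

text \<open>In the plane through the ray and the fixed point, that point has height
  \<open>sqrt (q - \<alpha>\<^sup>2)\<close> over the line. The triangle inequality of the complex
  plane then applies.\<close>

lemma ray_dist_complex: "ray_dist q \<alpha> s = cmod (Complex (sqrt (q - \<alpha>\<^sup>2)) (s - \<alpha>))"
  using q by (simp add: ray_dist_def cmod_def power2_eq_square algebra_simps)

lemma ray_dist_square: "(ray_dist q \<alpha> s)\<^sup>2 = q - 2 * s * \<alpha> + s\<^sup>2"
  unfolding ray_dist_complex cmod_power2 using q by (simp add: power2_eq_square algebra_simps)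

lemma ray_dist_nonneg: "0 \<le> ray_dist q \<alpha> s"
  by (simp add: ray_dist_complex)

lemma ray_dist_Lipschitz: "\<bar>ray_dist q \<alpha> s - ray_dist q \<alpha> s'\<bar> \<le> \<bar>s - s'\<bar>"
proof -
  have "\<bar>ray_dist q \<alpha> s - ray_dist q \<alpha> s'\<bar> \<le> cmod (Complex (sqrt (q - \<alpha>\<^sup>2)) (s - \<alpha>) - Complex (sqrt (q - \<alpha>\<^sup>2)) (s' - \<alpha>))"
    unfolding ray_dist_complex by (rule norm_triangle_ineq3)
  also have "\<dots> = \<bar>s - s'\<bar>" by (simp add: cmod_def)
  finally show ?thesis .
qed

text \<open>As \<open>s\<close> grows, distance minus \<open>s\<close> tends to
  \<open>- \<alpha>\<close>. The rate comes from factoring: \<open>?E + s\<close>, which is at least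
  \<open>s\<close>, times the error equals \<open>q + \<alpha> * (?E - s)\<close>, which is
  bounded.\<close>

lemma ray_dist_far:
  assumes "s > 0"
  shows "\<bar>ray_dist q \<alpha> s - s + \<alpha>\<bar> \<le> 2 * R\<^sup>2 / s"
proof -
  let ?E = "ray_dist q \<alpha> s"
  have a: "\<bar>\<alpha>\<bar> \<le> R" using q by (metis abs_le_square_iff abs_of_pos order_trans)
  have "\<bar>?E - s\<bar> \<le> R"
  proof -
    have r: "ray_dist q \<alpha> 0 \<le> R" unfolding ray_dist_def using q by (simp add: real_le_lsqrt)
    have u: "?E \<le> s + R" using ray_dist_Lipschitz[of s 0] r assms by simp
    have "s - R \<le> ?E"
    proof -
      have "sqrt q \<le> R" using q by (simp add: real_le_lsqrt)
      have "\<alpha> \<le> sqrt q" using q by (simp add: real_le_rsqrt)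
      then have "(s - sqrt q)\<^sup>2 \<le> ?E\<^sup>2"
        unfolding ray_dist_square using q assms order_trans[OF zero_le_power2 q(1)]
        by (simp add: power2_diff)
      then have "s - sqrt q \<le> ?E"
        using ray_dist_nonneg[of s] by (metis power2_le_imp_le)
      then show ?thesis using \<open>sqrt q \<le> R\<close> by linarith
    qed
    with u show ?thesis by linarith
  qed
  then have "\<bar>\<alpha> * (?E - s)\<bar> \<le> R * R" unfolding abs_mult using a q by (intro mult_mono) auto
  moreover have "(?E + s) * (?E - s + \<alpha>) = q + \<alpha> * (?E - s)"
    using ray_dist_square[of s] by (simp add: power2_eq_square algebra_simps)
  moreover have "0 \<le> q" using q by (metis zero_le_power2 order_trans)
  ultimately have "\<bar>(?E + s) * (?E - s + \<alpha>)\<bar> \<le> 2 * R\<^sup>2"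
    using q by (simp add: power2_eq_square)
  then have "(?E + s) * \<bar>?E - s + \<alpha>\<bar> \<le> 2 * R\<^sup>2"
    using ray_dist_nonneg[of s] assms by (simp add: abs_mult)
  moreover have "s * \<bar>?E - s + \<alpha>\<bar> \<le> (?E + s) * \<bar>?E - s + \<alpha>\<bar>"
    using ray_dist_nonneg[of s] by (intro mult_right_mono) auto
  ultimately show ?thesis using assms by (simp add: field_simps)
qed

text \<open>Justifies rounding and truncating the radius: either the change is small and the
  Lipschitz bound applies, or both radii are so large that distance minus radius is within
  \<open>t\<close> of its limit.\<close>

lemma ray_dist_move:
  assumes "0 \<le> s'" "s' \<le> s" "s - s' \<le> t \<or> 4 * R\<^sup>2 \<le> 2 * t * s' \<and> s' > 0"
  shows "\<bar>(ray_dist q \<alpha> s - s) - (ray_dist q \<alpha> s' - s')\<bar> \<le> 2 * t"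
  using assms(3)
proof
  assume "s - s' \<le> t"
  then show ?thesis using ray_dist_Lipschitz[of s s'] assms by linarith
next
  assume *: "4 * R\<^sup>2 \<le> 2 * t * s' \<and> s' > 0"
  then have t: "2 * R\<^sup>2 / s' \<le> t" by (simp add: field_simps)
  have "2 * R\<^sup>2 / s \<le> 2 * R\<^sup>2 / s'" using * assms by (intro divide_left_mono) auto
  then show ?thesis using ray_dist_far[of s] ray_dist_far[of s'] t * assms by linarith
qed

end


text \<open>Polar coordinates of \<open>u\<close> about \<open>x0\<close>. If \<open>s = 0\<close>,
  division by zero makes \<open>w\<close> vanish, hence an inequality for its norm; the same bound
  also serves for normalised differences of data points.\<close>

lemma nearest_point_ray:
  assumes s: "s = edist d u x0" and w: "w = (\<lambda>i. (u i - x0 i) / s)"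
  shows "ip d w w \<le> 1"
    and "edist d x u = ray_dist ((edist d x x0)\<^sup>2) (ip d (\<lambda>i. x i - x0 i) w) s"
    and "(ip d (\<lambda>i. x i - x0 i) w)\<^sup>2 \<le> (edist d x x0)\<^sup>2"
proof -
  have s2: "s\<^sup>2 = (\<Sum>i<d. (u i - x0 i)\<^sup>2)"
    unfolding s edist_square by (simp add: ip_def power2_eq_square)
  have sw: "u i - x0 i = s * w i" if "i < d" for i
  proof (cases "s = 0")
    case True
    then have "(\<Sum>i<d. (u i - x0 i)\<^sup>2) = 0" using s2 by simp
    then have "u i - x0 i = 0" using that by (subst (asm) sum_nonneg_eq_0_iff) auto
    then show ?thesis using True by simp
  qed (simp add: w)
  have "s\<^sup>2 * ip d w w = (\<Sum>i<d. (u i - x0 i)\<^sup>2)"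
    unfolding ip_def sum_distrib_left by (intro sum.cong refl) (simp add: sw power2_eq_square)
  then have s2w: "s\<^sup>2 * ip d w w = s\<^sup>2" by (simp add: s2)
  then have ww: "s = 0 \<or> ip d w w = 1" by simp
  moreover have "ip d w w = 0" if "s = 0" using that by (simp add: w ip_def)
  ultimately show w1: "ip d w w \<le> 1" by fastforce
  have "(ip d (\<lambda>i. x i - x0 i) w)\<^sup>2 \<le> (edist d x x0)\<^sup>2 * ip d w w"
    unfolding edist_square by (rule ip_Cauchy_Schwarz)
  also have "\<dots> \<le> (edist d x x0)\<^sup>2" using w1 by (simp add: mult_left_le)
  finally show "(ip d (\<lambda>i. x i - x0 i) w)\<^sup>2 \<le> (edist d x x0)\<^sup>2" .
  have "(edist d x u)\<^sup>2 = ip d (\<lambda>i. (x i - x0 i) - s * w i) (\<lambda>i. (x i - x0 i) - s * w i)"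
    unfolding edist_square ip_def by (intro sum.cong refl) (simp flip: sw)
  also have "\<dots> = (edist d x x0)\<^sup>2 - 2 * s * ip d (\<lambda>i. x i - x0 i) w + s\<^sup>2 * ip d w w"
    unfolding edist_square ip_diff_scaled by (simp add: ip_commute)
  also note s2w
  finally show "edist d x u = ray_dist ((edist d x x0)\<^sup>2) (ip d (\<lambda>i. x i - x0 i) w) s"
    unfolding ray_dist_def by (intro real_sqrt_unique[symmetric] edist_nonneg)
qed

text \<open>Estimates \<open>edist d x u - s + b\<close> from an approximate direction
  \<open>v\<close> of \<open>u\<close> seen from \<open>x0\<close>. The radicand is clamped because
  it can be negative for an inexact \<open>v\<close>.\<close>

definition ray_approx :: "nat \<Rightarrow> pt \<Rightarrow> pt \<Rightarrow> real \<Rightarrow> real \<Rightarrow> pt \<Rightarrow> real" where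
  "ray_approx d x0 v s b x =
    sqrt (max 0 ((edist d x x0)\<^sup>2 - 2 * s * ip d (\<lambda>i. x i - x0 i) v + s\<^sup>2)) - s + b"

text \<open>Since \<open>x0\<close> is the point of \<open>X\<close> nearest to \<open>u\<close>, an error \<open>e \<parallel>x - x0\<parallel>\<close> in the inner product is
  divided by a distance that is at least \<open>s\<close>, so it enters the distance with a constant factor only,
  however large \<open>s\<close> is.\<close>

lemma nearest_distance_approx:
  assumes fin: "finite X" "X \<noteq> {}" and R: "\<And>x y. x \<in> X \<Longrightarrow> y \<in> X \<Longrightarrow> edist d x y \<le> R"
    and t: "0 < t" "t \<le> R" and A: "128 * R\<^sup>2 / t\<^sup>2 \<le> real A"
    and b: "0 \<le> b" "b \<le> R"
  obtains x0 l j i where "x0 \<in> X" "set l \<subseteq> {-1, 1} \<times> (\<lambda>x i. (x i - x0 i) / edist d x x0) ` X" "length l = A"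
    "j \<le> A" "i \<le> A"
    "\<And>x. x \<in> X \<Longrightarrow> \<bar>edist d x u - (MIN x\<in>X. edist d x u) + b
      - ray_approx d x0 (signed_comb (t / (8 * R)) l) (real j * (t / 8)) (real i * (t / 8)) x\<bar> \<le> t"
proof -
  have "R > 0" using t by linarith
  \<comment> \<open>The error is \<open>2 * \<eta>\<close> for the radius,
    \<open>2 * (e * R)\<close> for the direction and \<open>\<eta>\<close> for the offset; as
    \<open>e * R = \<eta>\<close>, the total \<open>5 * t / 8\<close> is below
    \<open>t\<close>.\<close>
  define \<eta> where "\<eta> = t / 8"
  define e where "e = t / (8 * R)"
  have pos: "\<eta> > 0" "e > 0" using t \<open>R > 0\<close> by (auto simp: \<eta>_def e_def)
  have A': "128 * R\<^sup>2 \<le> A * t\<^sup>2" using A t by (simp add: field_simps)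
  have "(MIN x\<in>X. edist d x u) \<in> (\<lambda>x. edist d x u) ` X" using fin by (intro Min_in) auto
  then obtain x0 where x0: "x0 \<in> X" "edist d x0 u = (MIN x\<in>X. edist d x u)" by force
  define s where "s = edist d u x0"
  define w where "w = (\<lambda>i. (u i - x0 i) / s)"
  have s: "s = (MIN x\<in>X. edist d x u)" using x0 by (simp add: s_def edist_commute)
  have s_le: "s \<le> edist d x u" if "x \<in> X" for x unfolding s using fin that by simp
  have s0: "s \<ge> 0" by (simp add: s_def edist_nonneg)
  define Y where "Y = (\<lambda>x i. (x i - x0 i) / edist d x x0) ` X"
  have "edist d x0 x0 = 0" by (simp add: edist_def L2_set_def)
  then have Y0: "(\<lambda>_. 0) \<in> Y" unfolding Y_def using x0 by (intro image_eqI[of _ _ x0]) auto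
  have Y1: "ip d y y \<le> 1" if "y \<in> Y" for y
    using that nearest_point_ray(1)[OF refl refl] by (auto simp: Y_def)
  have "64 * R\<^sup>2 \<le> A * t\<^sup>2" using A' zero_le_power2[of R] by linarith
  then have "1 \<le> A * e\<^sup>2" using \<open>R > 0\<close> by (simp add: e_def power2_eq_square field_simps)
  with perceptron_approximation[OF Y0 Y1, of w e A] nearest_point_ray(1)[OF s_def w_def] pos
  obtain l where l: "set l \<subseteq> {-1, 1} \<times> Y" "length l = A"
    "\<And>y. y \<in> Y \<Longrightarrow> \<bar>ip d y (\<lambda>i. w i - signed_comb e l i)\<bar> \<le> e"
    by blast
  \<comment> \<open>The grid of radii stops at \<open>A * \<eta>\<close>: beyond it distance minus
    radius is nearly constant. The factor 128 in the bound on \<open>A\<close> is what this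
    truncation requires.\<close>
  define j where "j = min (nat \<lfloor>s / \<eta>\<rfloor>) A"
  define s' where "s' = real j * \<eta>"
  define i where "i = nat \<lfloor>b / \<eta>\<rfloor>"
  have fl: "real (nat \<lfloor>a / \<eta>\<rfloor>) * \<eta> \<le> a" "a \<le> real (nat \<lfloor>a / \<eta>\<rfloor>) * \<eta> + \<eta>" if "a \<ge> 0" for a
  proof -
    have "real (nat \<lfloor>a / \<eta>\<rfloor>) = of_int \<lfloor>a / \<eta>\<rfloor>" using that pos by simp
    then have "real (nat \<lfloor>a / \<eta>\<rfloor>) \<le> a / \<eta>" "a / \<eta> \<le> real (nat \<lfloor>a / \<eta>\<rfloor>) + 1" by linarith+
    then show "real (nat \<lfloor>a / \<eta>\<rfloor>) * \<eta> \<le> a" "a \<le> real (nat \<lfloor>a / \<eta>\<rfloor>) * \<eta> + \<eta>"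
      by (simp_all only: pos_le_divide_eq[OF pos(1)] pos_divide_le_eq[OF pos(1)] distrib_right mult_1_left)
  qed
  have "real i \<le> A"
  proof -
    have "real i * \<eta> \<le> R" using fl(1)[OF b(1)] b by (simp add: i_def)
    then have "real i * t \<le> 8 * R" by (simp add: \<eta>_def)
    from mult_mono[OF this t(2)] have "real i * t * t \<le> 8 * R * R" using t \<open>R > 0\<close> by simp
    also have "8 * R * R \<le> A * t * t"
      using A' zero_le_square[of R] unfolding power2_eq_square mult.assoc by linarith
    finally show ?thesis using t by simp
  qed
  have s'0: "0 \<le> s'" using pos by (simp add: s'_def)
  have "s' \<le> real (nat \<lfloor>s / \<eta>\<rfloor>) * \<eta>" using pos by (simp add: s'_def j_def)
  then have s's: "s' \<le> s" using fl(1)[OF s0] by linarith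
  have cases: "s - s' \<le> \<eta> \<or> 4 * R\<^sup>2 \<le> 2 * \<eta> * s' \<and> s' > 0"
  proof (cases "nat \<lfloor>s / \<eta>\<rfloor> \<le> A")
    case True
    then show ?thesis using fl(2)[OF s0] by (simp add: s'_def j_def)
  next
    case False
    then have s': "s' = A * \<eta>" by (simp add: s'_def j_def)
    have "A > 0" using A' \<open>R > 0\<close> by (cases "A = 0") auto
    have "2 * \<eta> * (A * \<eta>) = A * t\<^sup>2 / 32" by (simp add: \<eta>_def power2_eq_square)
    then have "4 * R\<^sup>2 \<le> 2 * \<eta> * (A * \<eta>)" using A' by linarith
    then show ?thesis unfolding s' using pos \<open>A > 0\<close> by simp
  qed
  have main: "\<bar>edist d x u - s + b - ray_approx d x0 (signed_comb e l) s' (i * \<eta>) x\<bar> \<le> t" if x: "x \<in> X" for x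
  proof -
    define q where "q = (edist d x x0)\<^sup>2"
    define \<alpha> where "\<alpha> = ip d (\<lambda>i. x i - x0 i) w"
    define \<alpha>' where "\<alpha>' = ip d (\<lambda>i. x i - x0 i) (signed_comb e l)"
    have E: "edist d x u = ray_dist q \<alpha> s" and aq: "\<alpha>\<^sup>2 \<le> q"
      using nearest_point_ray(2,3)[OF s_def w_def, of x] by (auto simp: q_def \<alpha>_def)
    have qR: "q \<le> R\<^sup>2" unfolding q_def using R[OF x x0(1)] by (intro power_mono) (auto simp: edist_nonneg)
    note q = aq qR \<open>R > 0\<close>
    have move: "\<bar>(ray_dist q \<alpha> s - s) - (ray_dist q \<alpha> s' - s')\<bar> \<le> 2 * \<eta>"
      by (rule ray_dist_move[OF q s'0 s's cases])
    have "\<bar>\<alpha> - \<alpha>'\<bar> \<le> e * R"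
    proof -
      define y where "y = (\<lambda>i. (x i - x0 i) / edist d x x0)"
      have edy: "x i - x0 i = edist d x x0 * y i" if "i < d" for i
      proof (cases "edist d x x0 = 0")
        case True
        then have "x i - x0 i = 0" using that by (auto simp: edist_def L2_set_eq_0_iff)
        then show ?thesis using True by simp
      qed (simp add: y_def)
      have "\<alpha> - \<alpha>' = edist d x x0 * ip d y (\<lambda>i. w i - signed_comb e l i)"
        unfolding \<alpha>_def \<alpha>'_def ip_def sum_distrib_left sum_subtractf[symmetric]
        by (intro sum.cong refl) (simp add: edy right_diff_distrib)
      then have "\<bar>\<alpha> - \<alpha>'\<bar> = edist d x x0 * \<bar>ip d y (\<lambda>i. w i - signed_comb e l i)\<bar>"
        by (simp add: abs_mult edist_nonneg)
      also have "\<dots> \<le> R * e"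
        using R[OF x x0(1)] l(3)[of y] x \<open>R > 0\<close> by (intro mult_mono) (auto simp: Y_def y_def)
      finally show ?thesis by (simp add: mult.commute)
    qed
    \<comment> \<open>Moving from \<open>s\<close> to \<open>s'\<close> lowers the distance by at
      most \<open>s - s'\<close>, so the nearest-point inequality survives rounding.\<close>
    moreover have "s' \<le> ray_dist q \<alpha> s'"
      using ray_dist_Lipschitz[OF q, of s s'] s_le[OF x] s's unfolding E by linarith
    ultimately have "\<bar>ray_dist q \<alpha> s' - sqrt (max 0 (q - 2 * s' * \<alpha>' + s'\<^sup>2))\<bar> \<le> 2 * (e * R)"
      using pos \<open>R > 0\<close> s'0 by (intro abs_sqrt_diff_le[OF _ _ ray_dist_square[OF q]]) auto
    moreover have "e * R = \<eta>" using \<open>R > 0\<close> by (simp add: e_def \<eta>_def)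
    moreover have "\<bar>b - i * \<eta>\<bar> \<le> \<eta>" using fl[OF b(1)] by (simp add: i_def)
    ultimately show ?thesis
      using move t unfolding ray_approx_def q_def[symmetric] \<alpha>'_def[symmetric] E \<eta>_def by linarith
  qed
  show ?thesis
    by (rule that[of x0 l j i]) (use x0 l main \<open>real i \<le> A\<close> in \<open>auto simp: j_def Y_def s s'_def \<eta>_def e_def\<close>)
qed

text \<open>The count multiplies the choices of the nearest point, of a list of \<open>A\<close>
  signed differences, and of two grid indices.\<close>

lemma nearest_distance_cover:
  assumes fin: "finite X" "X \<noteq> {}" and R: "\<And>x y. x \<in> X \<Longrightarrow> y \<in> X \<Longrightarrow> edist d x y \<le> R"
    and t: "0 < t" "t \<le> R" and A: "128 * R\<^sup>2 / t\<^sup>2 \<le> real A"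
  obtains H where "finite H" "card H \<le> card X * ((2 * card X) ^ A * (Suc A * Suc A))"
    "\<And>u b. 0 \<le> b \<Longrightarrow> b \<le> R \<Longrightarrow>
      \<exists>f\<in>H. \<forall>x\<in>X. \<bar>edist d x u - (MIN x\<in>X. edist d x u) + b - f x\<bar> \<le> t"
proof -
  define Y where "Y x0 = {-1, 1 :: real} \<times> (\<lambda>x i. (x i - x0 i) / edist d x x0) ` X" for x0
  define I where "I x0 = {l. set l \<subseteq> Y x0 \<and> length l = A} \<times> {..A} \<times> {..A}" for x0
  define F where "F x0 = (\<lambda>(l, j, i). ray_approx d x0 (signed_comb (t / (8 * R)) l) (real j * (t / 8)) (real i * (t / 8)))" for x0
  define H where "H = (\<Union>x0\<in>X. F x0 ` I x0)"
  have finY: "finite (Y x0)" for x0 using fin by (simp add: Y_def)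
  have cardY: "card (Y x0) \<le> 2 * card X" for x0
    using card_image_le[OF fin(1), of "\<lambda>x i. (x i - x0 i) / edist d x x0"]
    by (simp add: Y_def card_cartesian_product)
  have finI: "finite (I x0)" for x0
    using finite_lists_length_eq[OF finY] by (simp add: I_def)
  have "card (F x0 ` I x0) \<le> (2 * card X) ^ A * (Suc A * Suc A)" for x0
  proof -
    have "card (F x0 ` I x0) \<le> card (I x0)" by (rule card_image_le[OF finI])
    also have "\<dots> = card (Y x0) ^ A * (Suc A * Suc A)"
      by (simp add: I_def card_cartesian_product card_lists_length_eq[OF finY])
    also have "\<dots> \<le> (2 * card X) ^ A * (Suc A * Suc A)"
      by (intro mult_right_mono power_mono cardY) auto
    finally show ?thesis .
  qed
  then have "card H \<le> (\<Sum>x0\<in>X. (2 * card X) ^ A * (Suc A * Suc A))"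
    unfolding H_def using fin by (intro order_trans[OF card_UN_le] sum_mono)
  moreover have "\<exists>f\<in>H. \<forall>x\<in>X. \<bar>edist d x u - (MIN x\<in>X. edist d x u) + b - f x\<bar> \<le> t"
    if "0 \<le> b" "b \<le> R" for u b
  proof -
    obtain x0 l j i where *: "x0 \<in> X" "set l \<subseteq> Y x0" "length l = A" "j \<le> A" "i \<le> A"
      "\<And>x. x \<in> X \<Longrightarrow> \<bar>edist d x u - (MIN x\<in>X. edist d x u) + b - F x0 (l, j, i) x\<bar> \<le> t"
      by (rule nearest_distance_approx[OF fin R t A \<open>0 \<le> b\<close> \<open>b \<le> R\<close>, of u]) (auto simp: Y_def F_def)
    then have "F x0 (l, j, i) \<in> H" unfolding H_def I_def by blast
    with * show ?thesis by blast
  qed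
  ultimately show ?thesis
    using fin finI by (intro that[of H]) (auto simp: H_def)
qed

section \<open>From single centres to minima over at most \<open>k\<close> centres\<close>

lemma abs_Min_diff_le:
  fixes f g :: "'a \<Rightarrow> real"
  assumes "finite C" "C \<noteq> {}" "\<And>u. u \<in> C \<Longrightarrow> \<bar>f u - g u\<bar> \<le> t"
  shows "\<bar>(MIN u\<in>C. f u) - (MIN u\<in>C. g u)\<bar> \<le> t"
proof -
  have "(MIN u\<in>C. f u) - t \<le> (MIN u\<in>C. g u)" if "\<And>u. u \<in> C \<Longrightarrow> \<bar>f u - g u\<bar> \<le> t" for f g :: "'a \<Rightarrow> real"
  proof -
    have "(MIN u\<in>C. f u) - t \<le> g u" if "u \<in> C" for u
    proof -
      have "(MIN u\<in>C. f u) \<le> f u" using assms that by simp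
      then show ?thesis using \<open>\<And>u. u \<in> C \<Longrightarrow> \<bar>f u - g u\<bar> \<le> t\<close>[OF that] by linarith
    qed
    then show ?thesis using assms by simp
  qed
  from this[of f g] this[of g f] assms(3) show ?thesis by (simp add: abs_minus_commute abs_le_iff)
qed

text \<open>Padding by repetition does not change a minimum, so every choice of at most
  \<open>k\<close> centres is counted among lists of length exactly \<open>k\<close>.\<close>

lemma list_of_set_with_length:
  assumes "finite C" "C \<noteq> {}" "card C \<le> k"
  obtains cs where "set cs = C" "length cs = k"
proof -
  obtain xs where xs: "set xs = C" "distinct xs" using finite_distinct_list assms(1) by blast
  then have "length xs \<le> k" "xs \<noteq> []" using assms distinct_card[of xs] by auto
  then show ?thesis using xs
    by (intro that[of "xs @ replicate (k - length xs) (hd xs)"]) (auto simp: set_replicate_conv_if)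
qed

lemma clustering_cover:
  assumes fin: "finite X" "X \<noteq> {}" and R: "\<And>x y. x \<in> X \<Longrightarrow> y \<in> X \<Longrightarrow> edist d x y \<le> R"
    and t: "0 < t" "t \<le> R" and A: "128 * R\<^sup>2 / t\<^sup>2 \<le> real A"
  obtains F where "finite F" "card F \<le> (card X * ((2 * card X) ^ A * (Suc A * Suc A))) ^ k"
    "\<And>C g. finite C \<Longrightarrow> C \<noteq> {} \<Longrightarrow> card C \<le> k \<Longrightarrow>
      \<exists>f\<in>F. \<exists>c. \<forall>x\<in>X. \<bar>(MIN u\<in>C. edist d x u - g u) - c - f x\<bar> \<le> t"
proof -
  obtain H where H: "finite H" "card H \<le> card X * ((2 * card X) ^ A * (Suc A * Suc A))"
    "\<And>u b. 0 \<le> b \<Longrightarrow> b \<le> R \<Longrightarrow>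
      \<exists>f\<in>H. \<forall>x\<in>X. \<bar>edist d x u - (MIN x\<in>X. edist d x u) + b - f x\<bar> \<le> t"
    using nearest_distance_cover[OF assms] by blast
  define F where "F = (\<lambda>l x. MIN f\<in>set l. f x) ` {l. set l \<subseteq> H \<and> length l = k}"
  have finl: "finite {l. set l \<subseteq> H \<and> length l = k}" by (rule finite_lists_length_eq[OF H(1)])
  have "card F \<le> card {l. set l \<subseteq> H \<and> length l = k}"
    unfolding F_def by (rule card_image_le[OF finl])
  also have "\<dots> = card H ^ k" by (rule card_lists_length_eq[OF H(1)])
  also have "\<dots> \<le> (card X * ((2 * card X) ^ A * (Suc A * Suc A))) ^ k"
    by (intro power_mono H(2)) simp
  finally have "card F \<le> (card X * ((2 * card X) ^ A * (Suc A * Suc A))) ^ k" .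
  moreover have "\<exists>f\<in>F. \<exists>c. \<forall>x\<in>X. \<bar>(MIN u\<in>C. edist d x u - g u) - c - f x\<bar> \<le> t"
    if C: "finite C" "C \<noteq> {}" "card C \<le> k" for C g
  proof -
    define s where "s u = (MIN x\<in>X. edist d x u)" for u
    define c where "c = (MIN u\<in>C. s u - g u)"
    \<comment> \<open>Relative to \<open>c\<close>, offsets are nonnegative and unbounded. Capping
      them at \<open>R\<close> puts them in the range of the cover without changing the
      minimum.\<close>
    define b where "b u = min R (s u - g u - c)" for u
    have c_le: "c \<le> s u - g u" if "u \<in> C" for u unfolding c_def using C that by simp
    have "c \<in> (\<lambda>u. s u - g u) ` C" unfolding c_def using C by (intro Min_in) auto
    then obtain v where v: "v \<in> C" "c = s v - g v" by blast
    have "\<exists>f\<in>H. \<forall>x\<in>X. \<bar>edist d x u - s u + b u - f x\<bar> \<le> t" if "u \<in> C" for u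
      unfolding s_def by (rule H(3)) (use t c_le[OF that] in \<open>auto simp: b_def\<close>)
    then obtain h where h: "\<And>u. u \<in> C \<Longrightarrow> h u \<in> H"
      "\<And>u x. u \<in> C \<Longrightarrow> x \<in> X \<Longrightarrow> \<bar>edist d x u - s u + b u - h u x\<bar> \<le> t"
      by metis
    obtain cs where cs: "set cs = C" "length cs = k" using list_of_set_with_length[OF C] .
    have "(\<lambda>x. MIN f\<in>set (map h cs). f x) \<in> F"
      unfolding F_def using h cs by (intro imageI) auto
    then have "(\<lambda>x. MIN u\<in>C. h u x) \<in> F"
      by (simp add: cs image_image)
    moreover have "\<bar>(MIN u\<in>C. edist d x u - g u) - c - (MIN u\<in>C. h u x)\<bar> \<le> t" if x: "x \<in> X" for x
    proof -
      have rng: "0 \<le> edist d x u - s u" "edist d x u - s u \<le> R" for u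
      proof -
        show "0 \<le> edist d x u - s u" unfolding s_def using fin x by simp
        have "s u \<in> (\<lambda>x. edist d x u) ` X" unfolding s_def using fin by (intro Min_in) auto
        then obtain x0 where "x0 \<in> X" "s u = edist d x0 u" by blast
        then show "edist d x u - s u \<le> R" using edist_triangle[of d x u x0] R[OF x, of x0] by simp
      qed
      have le: "(MIN u\<in>C. edist d x u - g u) - c \<le> (MIN u\<in>C. edist d x u - s u + b u)"
      proof -
        have "(MIN u\<in>C. edist d x u - g u) - c \<le> edist d x u - s u + b u" if u: "u \<in> C" for u
        proof (cases "s u - g u - c \<le> R")
          case True
          have "(MIN u\<in>C. edist d x u - g u) \<le> edist d x u - g u" using C u by simp
          then show ?thesis using True by (simp add: b_def)
        next
          case False
          \<comment> \<open>The centre \<open>v\<close> has offset 0 and contributes at most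
            \<open>R\<close>, while the capped term of \<open>u\<close> is at least
            \<open>R\<close>.\<close>
          have "(MIN u\<in>C. edist d x u - g u) \<le> edist d x v - g v" using C v by simp
          then show ?thesis using False v rng[of u] rng[of v] by (simp add: b_def)
        qed
        then show ?thesis using C by simp
      qed
      have ge: "(MIN u\<in>C. edist d x u - s u + b u) \<le> (MIN u\<in>C. edist d x u - g u) - c"
      proof -
        have "(MIN u\<in>C. edist d x u - s u + b u) + c \<le> edist d x u - g u" if u: "u \<in> C" for u
        proof -
          have "(MIN u\<in>C. edist d x u - s u + b u) \<le> edist d x u - s u + b u" using C u by simp
          then show ?thesis by (simp add: b_def)
        qed
        then have "(MIN u\<in>C. edist d x u - s u + b u) + c \<le> (MIN u\<in>C. edist d x u - g u)"
          using C by simp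
        then show ?thesis by linarith
      qed
      have "\<bar>(MIN u\<in>C. edist d x u - s u + b u) - (MIN u\<in>C. h u x)\<bar> \<le> t"
        using C h x by (intro abs_Min_diff_le) auto
      then show ?thesis using le ge by simp
    qed
    ultimately show ?thesis by (intro bexI[of _ "\<lambda>x. MIN u\<in>C. h u x"] exI[of _ c]) auto
  qed
  ultimately show ?thesis using finl by (intro that[of F]) (auto simp: F_def)
qed

section \<open>Uniform deviations and assignment costs\<close>

text \<open>Feasibility of the product assignment: the infimum defining \<open>cost\<close> then
  ranges over a nonempty set.\<close>

lemma consistent_product:
  assumes "assignment_constraint Q w C \<Gamma>" "\<And>x. x \<in> Q \<Longrightarrow> 0 \<le> w x" "(\<Sum>x\<in>Q. w x) > 0"
  shows "consistent Q w C \<Gamma> (\<lambda>x u. w x * \<Gamma> u / (\<Sum>x\<in>Q. w x))"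
  using assms unfolding assignment_constraint_def consistent_def
  by (auto simp flip: sum_divide_distrib sum_distrib_left sum_distrib_right)

lemma transport_value_nonneg:
  assumes "consistent Q w C \<Gamma> \<sigma>"
  shows "0 \<le> (\<Sum>x\<in>Q. \<Sum>u\<in>C. \<sigma> x u * edist d x u)"
  using assms by (auto simp: consistent_def edist_nonneg intro!: sum_nonneg mult_nonneg_nonneg)

lemma cost_nonneg:
  assumes "consistent Q w C \<Gamma> \<sigma>"
  shows "0 \<le> cost d Q w C \<Gamma>"
  unfolding cost_def using assms by (intro cINF_greatest) (auto intro: transport_value_nonneg)

lemma cost_le_value:
  assumes "consistent Q w C \<Gamma> \<sigma>"
  shows "cost d Q w C \<Gamma> \<le> (\<Sum>x\<in>Q. \<Sum>u\<in>C. \<sigma> x u * edist d x u)"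
  unfolding cost_def using assms
  by (intro cINF_lower bdd_belowI2[where m = 0]) (auto intro: transport_value_nonneg)

text \<open>A consistent assignment sends nothing to centres of capacity 0, so the minimum may run
  over \<open>C'\<close> alone, where capacities are positive as the Gibbs argument demands.\<close>

lemma weak_duality:
  assumes "finite Q" "finite C" "consistent Q w C \<Gamma> \<sigma>"
    and C': "C' = {u \<in> C. 0 < \<Gamma> u}" "C' \<noteq> {}"
  shows "(\<Sum>x\<in>Q. w x * (MIN u\<in>C'. edist d x u - g u)) + (\<Sum>u\<in>C'. \<Gamma> u * g u)
    \<le> (\<Sum>x\<in>Q. \<Sum>u\<in>C. \<sigma> x u * edist d x u)"
proof -
  have fin: "finite C'" "C' \<subseteq> C" using assms by auto
  have \<sigma>0: "0 \<le> \<sigma> x u" if "x \<in> Q" "u \<in> C" for x u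
    using assms that by (auto simp: consistent_def)
  have zero: "\<sigma> x u = 0" if "x \<in> Q" "u \<in> C - C'" for x u
  proof -
    have "(\<Sum>x\<in>Q. \<sigma> x u) = \<Gamma> u" using assms that by (auto simp: consistent_def)
    moreover have "\<Gamma> u \<le> 0" using C' that by auto
    moreover have "0 \<le> (\<Sum>x\<in>Q. \<sigma> x u)" using that \<sigma>0 by (intro sum_nonneg) auto
    ultimately have "(\<Sum>x\<in>Q. \<sigma> x u) = 0" by linarith
    then show ?thesis using assms that \<sigma>0 by (subst (asm) sum_nonneg_eq_0_iff) auto
  qed
  have row: "(\<Sum>u\<in>C'. \<sigma> x u) = w x" if "x \<in> Q" for x
  proof -
    have "(\<Sum>u\<in>C'. \<sigma> x u) = (\<Sum>u\<in>C. \<sigma> x u)"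
      using assms fin zero that by (intro sum.mono_neutral_left) auto
    then show ?thesis using assms that by (auto simp: consistent_def)
  qed
  have "(\<Sum>x\<in>Q. w x * (MIN u\<in>C'. edist d x u - g u)) \<le> (\<Sum>x\<in>Q. \<Sum>u\<in>C'. \<sigma> x u * (edist d x u - g u))"
  proof (intro sum_mono)
    fix x assume x: "x \<in> Q"
    have "w x * (MIN u\<in>C'. edist d x u - g u) = (\<Sum>u\<in>C'. \<sigma> x u * (MIN u\<in>C'. edist d x u - g u))"
      using row[OF x] by (simp flip: sum_distrib_right)
    also have "\<dots> \<le> (\<Sum>u\<in>C'. \<sigma> x u * (edist d x u - g u))"
      using fin \<sigma>0 x by (intro sum_mono mult_left_mono) auto
    finally show "w x * (MIN u\<in>C'. edist d x u - g u) \<le> (\<Sum>u\<in>C'. \<sigma> x u * (edist d x u - g u))" .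
  qed
  also have "\<dots> = (\<Sum>x\<in>Q. \<Sum>u\<in>C'. \<sigma> x u * edist d x u) - (\<Sum>x\<in>Q. \<Sum>u\<in>C'. \<sigma> x u * g u)"
    by (simp add: right_diff_distrib sum_subtractf)
  also have "(\<Sum>x\<in>Q. \<Sum>u\<in>C'. \<sigma> x u * g u) = (\<Sum>u\<in>C'. \<Gamma> u * g u)"
    using assms(3) fin by (subst sum.swap) (auto simp: consistent_def simp flip: sum_distrib_right intro!: sum.cong)
  also have "(\<Sum>x\<in>Q. \<Sum>u\<in>C'. \<sigma> x u * edist d x u) = (\<Sum>x\<in>Q. \<Sum>u\<in>C. \<sigma> x u * edist d x u)"
    using assms fin zero by (intro sum.cong refl sum.mono_neutral_left) auto
  finally show ?thesis by simp
qed

text \<open>Near-optimal prices for \<open>Q'\<close> are transferred to \<open>Q\<close> by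
  \<open>dev\<close>, where weak duality bounds their value by the cost. The term in
  \<open>\<Gamma>\<close> is common to both sides.\<close>

lemma cost_le_of_dual_deviation:
  assumes fin: "finite Q" "finite Q'" "finite C"
    and w: "\<And>x. x \<in> Q \<Longrightarrow> 0 \<le> w x" "\<And>x. x \<in> Q' \<Longrightarrow> 0 \<le> w' x" "(\<Sum>x\<in>Q. w x) > 0"
    and \<Gamma>: "assignment_constraint Q w C \<Gamma>" "assignment_constraint Q' w' C \<Gamma>"
    and dev: "\<And>C' g. C' \<subseteq> C \<Longrightarrow> C' \<noteq> {} \<Longrightarrow>
      (\<Sum>x\<in>Q'. w' x * (MIN u\<in>C'. edist d x u - g u)) \<le> (\<Sum>x\<in>Q. w x * (MIN u\<in>C'. edist d x u - g u)) + \<Delta>"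
  shows "cost d Q' w' C \<Gamma> \<le> cost d Q w C \<Gamma> + \<Delta>"
proof (rule field_le_epsilon)
  fix \<eta> :: real assume \<eta>: "\<eta> > 0"
  define C' where "C' = {u \<in> C. 0 < \<Gamma> u}"
  define W where "W = (\<Sum>x\<in>Q'. w' x)"
  have C': "finite C'" "C' \<subseteq> C" using fin by (auto simp: C'_def)
  have \<Gamma>0: "\<Gamma> u = 0" if "u \<in> C - C'" for u
    using \<Gamma> that by (force simp: C'_def assignment_constraint_def)
  have sumC': "(\<Sum>u\<in>C'. \<Gamma> u) = (\<Sum>u\<in>C. \<Gamma> u)"
    using fin C' \<Gamma>0 by (intro sum.mono_neutral_left) auto
  have W: "W > 0" "(\<Sum>u\<in>C'. \<Gamma> u) = W"
    using w \<Gamma> sumC' by (auto simp: W_def assignment_constraint_def)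
  then have ne: "C' \<noteq> {}" by auto
  \<comment> \<open>Chosen so that the entropy error \<open>W * card C' / \<beta>\<close> equals
    \<open>\<eta>\<close>.\<close>
  define \<beta> where "\<beta> = W * card C' / \<eta>"
  have \<beta>: "\<beta> > 0" using W ne C' \<eta> by (simp add: \<beta>_def card_gt_0_iff)
  interpret st: soft_transport Q' w' C' \<Gamma> "edist d" \<beta>
  proof
    show "0 < \<Gamma> u" if "u \<in> C'" for u using that by (simp add: C'_def)
  qed (use fin(2) C'(1) ne w(2) W(2) \<beta> in \<open>simp_all add: W_def\<close>)
  obtain \<sigma> g where \<sigma>: "\<And>x u. x \<in> Q' \<Longrightarrow> 0 \<le> \<sigma> x u" "\<And>x. (\<Sum>u\<in>C'. \<sigma> x u) = w' x"
      "\<And>u. u \<in> C' \<Longrightarrow> (\<Sum>x\<in>Q'. \<sigma> x u) = \<Gamma> u"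
    and val: "(\<Sum>x\<in>Q'. \<Sum>u\<in>C'. \<sigma> x u * edist d x u) \<le>
      (\<Sum>x\<in>Q'. w' x * (MIN u\<in>C'. edist d x u - g u)) + (\<Sum>u\<in>C'. \<Gamma> u * g u) + (\<Sum>x\<in>Q'. w' x) * card C' / \<beta>"
    by (rule st.approx_duality) blast
  define \<sigma>' where "\<sigma>' x u = (if u \<in> C' then \<sigma> x u else 0)" for x u
  have restr: "(\<Sum>u\<in>C. \<sigma>' x u * h u) = (\<Sum>u\<in>C'. \<sigma> x u * h u)" for x h
    using fin C' by (intro sum.mono_neutral_cong_right) (auto simp: \<sigma>'_def)
  have col: "(\<Sum>x\<in>Q'. \<sigma>' x u) = \<Gamma> u" if "u \<in> C" for u
    using that \<sigma>(3)[of u] \<Gamma>0[of u] by (cases "u \<in> C'") (simp_all add: \<sigma>'_def)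
  have "0 \<le> \<sigma>' x u" if "x \<in> Q'" for x u using \<sigma>(1)[OF that] by (simp add: \<sigma>'_def)
  then have "consistent Q' w' C \<Gamma> \<sigma>'"
    using \<sigma>(2) col restr[where h = "\<lambda>_. 1"] by (simp add: consistent_def)
  then have "cost d Q' w' C \<Gamma> \<le> (\<Sum>x\<in>Q'. \<Sum>u\<in>C. \<sigma>' x u * edist d x u)"
    by (rule cost_le_value)
  also have "\<dots> = (\<Sum>x\<in>Q'. \<Sum>u\<in>C'. \<sigma> x u * edist d x u)" by (simp add: restr)
  also note val[folded W_def]
  also have "W * card C' / \<beta> = \<eta>" using W ne C' \<eta> by (simp add: \<beta>_def)
  finally have 1: "cost d Q' w' C \<Gamma> \<le> (\<Sum>x\<in>Q. w x * (MIN u\<in>C'. edist d x u - g u)) + (\<Sum>u\<in>C'. \<Gamma> u * g u) + \<Delta> + \<eta>"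
    using dev[OF C'(2) ne, of g] by linarith
  have "(\<Sum>x\<in>Q. w x * (MIN u\<in>C'. edist d x u - g u)) + (\<Sum>u\<in>C'. \<Gamma> u * g u) \<le> cost d Q w C \<Gamma>"
    unfolding cost_def
    using consistent_product[OF \<Gamma>(1) w(1,3)] weak_duality[OF fin(1,3) _ C'_def ne]
    by (intro cINF_greatest) auto
  then show "cost d Q' w' C \<Gamma> \<le> cost d Q w C \<Gamma> + \<Delta> + \<eta>" using 1 by linarith
qed

text \<open>The population \<open>S\<close> is a parameter because the notion is used both for
  \<open>P\<close> and for the small union of a sample with its ghost.\<close>

definition bad_samples :: "nat \<Rightarrow> nat \<Rightarrow> real \<Rightarrow> pt set \<Rightarrow> nat \<Rightarrow> pt set set" where
  "bad_samples d k t S m = {D \<in> subsets_of_size S m. \<exists>C g. finite C \<and> C \<noteq> {} \<and> card C \<le> k \<and>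
     t < \<bar>avg S (\<lambda>x. MIN u\<in>C. edist d x u - g u) - avg D (\<lambda>x. MIN u\<in>C. edist d x u - g u)\<bar>}"

lemma bad_samples_antimono:
  assumes "t' \<le> t"
  shows "bad_samples d k t S m \<subseteq> bad_samples d k t' S m"
proof
  fix D assume "D \<in> bad_samples d k t S m"
  then obtain C g where D: "D \<subseteq> S" "card D = m" and C: "finite C" "C \<noteq> {}" "card C \<le> k"
    and big: "t < \<bar>avg S (\<lambda>x. MIN u\<in>C. edist d x u - g u) - avg D (\<lambda>x. MIN u\<in>C. edist d x u - g u)\<bar>"
    unfolding bad_samples_def by blast
  from le_less_trans[OF assms big] show "D \<in> bad_samples d k t' S m"
    unfolding bad_samples_def using D C by blast
qed

lemma not_bad_samplesD:
  assumes "D \<in> subsets_of_size S m" "D \<notin> bad_samples d k t S m" "finite C" "C \<noteq> {}" "card C \<le> k"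
  shows "\<bar>avg S (\<lambda>x. MIN u\<in>C. edist d x u - g u) - avg D (\<lambda>x. MIN u\<in>C. edist d x u - g u)\<bar> \<le> t"
proof (rule ccontr)
  assume "\<not> ?thesis"
  then have "D \<in> bad_samples d k t S m"
    unfolding bad_samples_def mem_Collect_eq
    by (intro conjI[OF assms(1)[unfolded mem_Collect_eq]] exI[of _ C] exI[of _ g] conjI assms(3-5)) linarith
  then show False using assms(2) by contradiction
qed

text \<open>Multiplied by \<open>n\<close>, a deviation of averages becomes a deviation of weighted
  dual objectives; the duality comparison is applied in both directions.\<close>

lemma coreset_if_not_bad:
  assumes P: "finite P" "P \<subseteq> Rspace d" "card P = n" and m: "m > 0" and \<epsilon>: "\<epsilon> > 0"
    and D: "D \<in> subsets_of_size P m" "D \<notin> bad_samples d k (\<epsilon> * r) P m"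
  shows "assignment_preserving_coreset d k \<epsilon> (real n * r) P (\<lambda>x. 1) D (\<lambda>x. real n / real m)"
proof -
  have finD: "finite D" "D \<subseteq> P" "card D = m" using D P finite_subset by auto
  have n: "n > 0" using finD P m card_mono[of P D] by simp
  have weights: "(\<Sum>x\<in>D. real n / real m) = n" using finD m by simp
  have "\<bar>cost d P (\<lambda>x. 1) C \<Gamma> - cost d D (\<lambda>x. real n / real m) C \<Gamma>\<bar> \<le> \<epsilon> * (cost d P (\<lambda>x. 1) C \<Gamma> + n * r)"
    if C: "finite C" "card C \<le> k" and \<Gamma>: "assignment_constraint P (\<lambda>x. 1) C \<Gamma>" for C \<Gamma>
  proof -
    have \<Gamma>': "assignment_constraint D (\<lambda>x. real n / real m) C \<Gamma>"
      unfolding assignment_constraint_def weights using \<Gamma> P by (simp add: assignment_constraint_def)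
    have dev: "\<bar>(\<Sum>x\<in>P. 1 * (MIN u\<in>C'. edist d x u - g u)) - (\<Sum>x\<in>D. real n / real m * (MIN u\<in>C'. edist d x u - g u))\<bar>
        \<le> n * (\<epsilon> * r)" if C': "C' \<subseteq> C" "C' \<noteq> {}" for C' g
    proof -
      let ?\<phi> = "\<lambda>x. MIN u\<in>C'. edist d x u - g u"
      have "card C' \<le> k" "finite C'" using C C' card_mono[of C C'] finite_subset by auto
      then have "\<bar>avg P ?\<phi> - avg D ?\<phi>\<bar> \<le> \<epsilon> * r"
        using C' by (intro not_bad_samplesD[OF D]) auto
      then have "n * \<bar>avg P ?\<phi> - avg D ?\<phi>\<bar> \<le> n * (\<epsilon> * r)" by (intro mult_left_mono) auto
      moreover have "n * \<bar>avg P ?\<phi> - avg D ?\<phi>\<bar> = \<bar>n * avg P ?\<phi> - n * avg D ?\<phi>\<bar>"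
        unfolding right_diff_distrib[symmetric] abs_mult by simp
      moreover have "n * avg P ?\<phi> = (\<Sum>x\<in>P. 1 * ?\<phi> x)" using n P by simp
      moreover have "n * avg D ?\<phi> = (\<Sum>x\<in>D. real n / real m * ?\<phi> x)"
        using finD by (simp add: sum_distrib_left sum_divide_distrib)
      ultimately show ?thesis by simp
    qed
    have "cost d D (\<lambda>x. real n / real m) C \<Gamma> \<le> cost d P (\<lambda>x. 1) C \<Gamma> + n * (\<epsilon> * r)"
    proof (rule cost_le_of_dual_deviation)
      fix C' g assume "C' \<subseteq> C" "C' \<noteq> {}"
      then show "(\<Sum>x\<in>D. real n / real m * (MIN u\<in>C'. edist d x u - g u))
          \<le> (\<Sum>x\<in>P. 1 * (MIN u\<in>C'. edist d x u - g u)) + n * (\<epsilon> * r)"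
        using dev[of C' g] by linarith
    qed (use P finD C \<Gamma> \<Gamma>' n in simp_all)
    moreover have "cost d P (\<lambda>x. 1) C \<Gamma> \<le> cost d D (\<lambda>x. real n / real m) C \<Gamma> + n * (\<epsilon> * r)"
    proof (rule cost_le_of_dual_deviation)
      fix C' g assume "C' \<subseteq> C" "C' \<noteq> {}"
      then show "(\<Sum>x\<in>P. 1 * (MIN u\<in>C'. edist d x u - g u))
          \<le> (\<Sum>x\<in>D. real n / real m * (MIN u\<in>C'. edist d x u - g u)) + n * (\<epsilon> * r)"
        using dev[of C' g] by linarith
    qed (use P finD C \<Gamma> \<Gamma>' n m in simp_all)
    moreover have "0 \<le> cost d P (\<lambda>x. 1) C \<Gamma>"
      by (rule cost_nonneg[OF consistent_product[OF \<Gamma>]]) (use n P in simp_all)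
    then have "0 \<le> \<epsilon> * cost d P (\<lambda>x. 1) C \<Gamma>" using \<epsilon> by simp
    ultimately show ?thesis by (simp add: algebra_simps abs_le_iff)
  qed
  then show ?thesis
    unfolding assignment_preserving_coreset_def using finD P weights by auto
qed

section \<open>Union bound over the cover, and symmetrisation\<close>

lemma avg_close:
  assumes "finite S" "S \<noteq> {}" "\<And>x. x \<in> S \<Longrightarrow> \<bar>a x - c - f x\<bar> \<le> (e::real)"
  shows "\<bar>avg S a - c - avg S f\<bar> \<le> e"
proof -
  have c: "real (card S) > 0" using assms by (simp add: card_gt_0_iff)
  have "(\<Sum>x\<in>S. a x - c - f x) = real (card S) * (avg S a - c - avg S f)"
    using c by (simp add: sum_subtractf right_diff_distrib)
  moreover have "\<bar>\<Sum>x\<in>S. a x - c - f x\<bar> \<le> card S * e"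
    by (rule order_trans[OF sum_abs]) (use sum_bounded_above[of S _ e] assms(3) in simp)
  ultimately show ?thesis using c by (simp add: abs_mult)
qed

text \<open>The prices cancel termwise and a minimum of 1-Lipschitz functions is 1-Lipschitz, so the
  bound is uniform in \<open>C\<close> and \<open>g\<close>.\<close>

lemma Min_edist_oscillation:
  assumes "finite C" "C \<noteq> {}"
  shows "(MIN u\<in>C. edist d x u - g u) - (MIN u\<in>C. edist d y u - g u) \<le> edist d x y"
proof -
  have "\<bar>(MIN u\<in>C. edist d x u - g u) - (MIN u\<in>C. edist d y u - g u)\<bar> \<le> edist d x y"
  proof (rule abs_Min_diff_le[OF assms])
    fix u
    show "\<bar>edist d x u - g u - (edist d y u - g u)\<bar> \<le> edist d x y"
      using edist_triangle[of d x u y] edist_triangle[of d y u x] edist_commute[of d x y] by linarith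
  qed
  then show ?thesis by linarith
qed

text \<open>With cover accuracy \<open>t / 4\<close>, passing to a cover function loses
  \<open>t / 4\<close> in each of the two averages and leaves a deviation of \<open>t / 2\<close>.
  The constant 2048 is 128 times 16.\<close>

lemma card_bad_samples_cover:
  assumes S: "finite S" "m \<le> card S" "m > 0"
    and R: "\<And>x y. x \<in> S \<Longrightarrow> y \<in> S \<Longrightarrow> edist d x y \<le> R"
    and t: "0 < t" "t \<le> R" and A: "2048 * R\<^sup>2 / t\<^sup>2 \<le> real A"
  shows "card (bad_samples d k t S m) \<le>
    real ((card S * ((2 * card S) ^ A * (Suc A * Suc A))) ^ k) * (2 * (card S choose m) * exp (- real m * t\<^sup>2 / (8 * R\<^sup>2)))"
proof -
  define M where "M = (card S * ((2 * card S) ^ A * (Suc A * Suc A))) ^ k"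
  define Y where "Y = 2 * (card S choose m) * exp (- real m * t\<^sup>2 / (8 * R\<^sup>2))"
  have ne: "S \<noteq> {}" using S by auto
  have t4: "0 < t / 4" "t / 4 \<le> R" and A4: "128 * R\<^sup>2 / (t / 4)\<^sup>2 \<le> real A"
    using t A by (auto simp: power_divide)
  obtain F where F: "finite F" "card F \<le> M"
    "\<And>C g. finite C \<Longrightarrow> C \<noteq> {} \<Longrightarrow> card C \<le> k \<Longrightarrow>
      \<exists>f\<in>F. \<exists>c. \<forall>x\<in>S. \<bar>(MIN u\<in>C. edist d x u - g u) - c - f x\<bar> \<le> t / 4"
    using clustering_cover[OF S(1) ne R t4 A4, of k] unfolding M_def by blast
  \<comment> \<open>Hoeffding's inequality needs bounded oscillation. A cover function within
    \<open>t / 4\<close> of a shifted clustering function oscillates by at most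
    \<open>R + t / 2\<close>, so the others can be discarded.\<close>
  define F' where "F' = {f \<in> F. \<forall>x\<in>S. \<forall>y\<in>S. f x - f y \<le> 2 * R}"
  define B where "B f = {D \<in> subsets_of_size S m. \<bar>avg S f - avg D f\<bar> > t / 2}" for f
  have sub: "bad_samples d k t S m \<subseteq> (\<Union>f\<in>F'. B f)"
  proof
    fix D assume "D \<in> bad_samples d k t S m"
    then obtain C g where D: "D \<subseteq> S" "card D = m" and C: "finite C" "C \<noteq> {}" "card C \<le> k"
      and big: "t < \<bar>avg S (\<lambda>x. MIN u\<in>C. edist d x u - g u) - avg D (\<lambda>x. MIN u\<in>C. edist d x u - g u)\<bar>"
      unfolding bad_samples_def by blast
    define \<phi> where "\<phi> = (\<lambda>x. MIN u\<in>C. edist d x u - g u)"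
    obtain f c where f: "f \<in> F" "\<And>x. x \<in> S \<Longrightarrow> \<bar>\<phi> x - c - f x\<bar> \<le> t / 4"
      using F(3)[OF C, of g] unfolding \<phi>_def by blast
    have "f x - f y \<le> 2 * R" if "x \<in> S" "y \<in> S" for x y
      using f(2)[OF that(1)] f(2)[OF that(2)] Min_edist_oscillation[OF C(1,2), of d x g y] R[OF that] t
      unfolding \<phi>_def by linarith
    then have "f \<in> F'" using f by (simp add: F'_def)
    have "finite D" "D \<noteq> {}" using D S finite_subset by auto
    then have "\<bar>avg D \<phi> - c - avg D f\<bar> \<le> t / 4" using f D by (intro avg_close) auto
    moreover have "\<bar>avg S \<phi> - c - avg S f\<bar> \<le> t / 4" using f S ne by (intro avg_close) auto
    ultimately have "\<bar>avg S f - avg D f\<bar> > t / 2" using big unfolding \<phi>_def[symmetric] by linarith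
    then show "D \<in> (\<Union>f\<in>F'. B f)" using \<open>f \<in> F'\<close> D by (auto simp: B_def)
  qed
  have finF': "finite F'" "card F' \<le> card F" using F by (auto simp: F'_def intro: card_mono)
  have "card (bad_samples d k t S m) \<le> card (\<Union>f\<in>F'. B f)"
    using sub finF' S by (intro card_mono) (auto simp: B_def)
  also have "\<dots> \<le> (\<Sum>f\<in>F'. card (B f))" by (rule card_UN_le[OF finF'(1)])
  finally have "real (card (bad_samples d k t S m)) \<le> (\<Sum>f\<in>F'. real (card (B f)))"
    by (simp flip: of_nat_sum)
  also have "\<dots> \<le> (\<Sum>f\<in>F'. Y)"
  proof (intro sum_mono)
    fix f assume f: "f \<in> F'"
    have "card (B f) \<le> 2 * (card S choose m) * exp (- 2 * real m * (t / 2)\<^sup>2 / (2 * R)\<^sup>2)"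
      unfolding B_def by (rule sampling_tail) (use S t f in \<open>auto simp: F'_def\<close>)
    also have "- 2 * real m * (t / 2)\<^sup>2 / (2 * R)\<^sup>2 = - real m * t\<^sup>2 / (8 * R\<^sup>2)"
      by (simp add: power_divide power_mult_distrib)
    finally show "card (B f) \<le> Y" by (simp add: Y_def)
  qed
  also have "\<dots> = card F' * Y" by simp
  also have "\<dots> \<le> M * Y"
    using finF'(2) F(2) by (intro mult_right_mono) (simp_all add: Y_def)
  finally show ?thesis unfolding M_def Y_def .
qed

text \<open>Symmetrisation: a bad sample \<open>D\<close> can be completed in at least half of all ways by a ghost sample
  \<open>D'\<close> whose average is typical for \<open>P - D\<close>, and then \<open>D\<close> is bad inside \<open>D \<union> D'\<close>.\<close>

lemma card_bad_samples_symmetrization: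
  fixes \<eta> :: real
  assumes P: "finite P" "2 * m \<le> card P" "m > 0"
    and R: "\<And>x y. x \<in> P \<Longrightarrow> y \<in> P \<Longrightarrow> edist d x y \<le> R" and t: "0 < t" "0 < R"
    and half: "2 * exp (- real m * t\<^sup>2 / (2 * R\<^sup>2)) \<le> 1 / 2"
    and small: "\<And>S. S \<in> subsets_of_size P (2 * m) \<Longrightarrow>
      card (bad_samples d k (t / 4) S m) \<le> \<eta> * (2 * m choose m)"
  shows "card (bad_samples d k t P m) \<le> 2 * \<eta> * (card P choose m)"
proof -
  define n where "n = card P"
  let ?B = "bad_samples d k t P m"
  have "\<forall>D\<in>?B. \<exists>\<phi>. (\<exists>C g. finite C \<and> C \<noteq> {} \<and> card C \<le> k \<and> \<phi> = (\<lambda>x. MIN u\<in>C. edist d x u - g u))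
      \<and> t < \<bar>avg P \<phi> - avg D \<phi>\<bar>"
    unfolding bad_samples_def by blast
  \<comment> \<open>The witness depends on \<open>D\<close> alone, so the ghost sample is tested
    against one fixed function and no union bound is needed here.\<close>
  from bchoice[OF this] obtain \<phi> where \<phi>: "\<And>D. D \<in> ?B \<Longrightarrow>
      \<exists>C g. finite C \<and> C \<noteq> {} \<and> card C \<le> k \<and> \<phi> D = (\<lambda>x. MIN u\<in>C. edist d x u - g u)"
    and dev: "\<And>D. D \<in> ?B \<Longrightarrow> t < \<bar>avg P (\<phi> D) - avg D (\<phi> D)\<bar>"
    by blast
  define G where "G D = {D' \<in> subsets_of_size (P - D) m. \<bar>avg (P - D) (\<phi> D) - avg D' (\<phi> D)\<bar> \<le> t / 2}" for D
  have B: "D \<subseteq> P" "card D = m" "finite D" "card (P - D) = n - m" if "D \<in> ?B" for D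
    using that P finite_subset[of D P] by (auto simp: bad_samples_def card_Diff_subset n_def)
  have finB: "finite ?B" using P by (simp add: bad_samples_def)
  have G_large: "(n - m choose m) \<le> 2 * real (card (G D))" if D: "D \<in> ?B" for D
  proof -
    let ?T = "{D' \<in> subsets_of_size (P - D) m. \<bar>avg (P - D) (\<phi> D) - avg D' (\<phi> D)\<bar> > t / 2}"
    have "card ?T \<le> 2 * (card (P - D) choose m) * exp (- 2 * real m * (t / 2)\<^sup>2 / R\<^sup>2)"
    proof (rule sampling_tail)
      show "m \<le> card (P - D)" using B[OF D] P by (simp add: n_def)
      fix x y assume "x \<in> P - D" "y \<in> P - D"
      then have "edist d x y \<le> R" using R by simp
      moreover have "\<phi> D x - \<phi> D y \<le> edist d x y"
        using \<phi>[OF D] Min_edist_oscillation by force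
      ultimately show "\<phi> D x - \<phi> D y \<le> R" by linarith
    qed (use P t in auto)
    also have "\<dots> = (n - m choose m) * (2 * exp (- real m * t\<^sup>2 / (2 * R\<^sup>2)))"
      using B[OF D] by (simp add: power_divide)
    also have "\<dots> \<le> (n - m choose m) * (1 / 2)"
      using half by (intro mult_left_mono) auto
    finally have T: "2 * real (card ?T) \<le> (n - m choose m)" by simp
    have "subsets_of_size (P - D) m = G D \<union> ?T" by (auto simp: G_def)
    moreover have "card (subsets_of_size (P - D) m) = (n - m choose m)"
      using n_subsets[of "P - D" m] P B[OF D] by simp
    ultimately have "card (G D \<union> ?T) = (n - m choose m)" by (simp only:)
    then have "(n - m choose m) \<le> card (G D) + card ?T" using card_Un_le[of "G D" ?T] by linarith
    then show ?thesis using T by linarith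
  qed
  define pair where "pair = (\<lambda>(D::pt set, D'::pt set). (D \<union> D', D))"
  have inj: "inj_on pair (SIGMA D:?B. G D)"
  proof (rule inj_onI)
    fix a b assume ab: "a \<in> (SIGMA D:?B. G D)" "b \<in> (SIGMA D:?B. G D)" "pair a = pair b"
    obtain D D' E E' where eq: "a = (D, D')" "b = (E, E')" by (cases a, cases b)
    have "D' = (D \<union> D') - D" "E' = (E \<union> E') - E" using ab eq by (auto simp: G_def)
    then show "a = b" using ab eq by (auto simp: pair_def)
  qed
  have "pair ` (SIGMA D:?B. G D) \<subseteq> (SIGMA S:subsets_of_size P (2 * m). bad_samples d k (t / 4) S m)"
  proof (rule image_subsetI)
    fix z assume "z \<in> (SIGMA D:?B. G D)"
    then obtain D D' where z: "z = (D, D')" and D: "D \<in> ?B" and D': "D' \<in> G D" by blast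
    note BD = B[OF D]
    have D'2: "D' \<subseteq> P - D" "card D' = m" and close: "\<bar>avg (P - D) (\<phi> D) - avg D' (\<phi> D)\<bar> \<le> t / 2"
      using D' by (auto simp: G_def)
    have finD': "finite D'" using D'2 P finite_subset by blast
    have disj: "D \<inter> D' = {}" using D'2 by auto
    have cU: "card (D \<union> D') = 2 * m" using BD D'2 finD' disj by (simp add: card_Un_disjoint)
    have n: "real n > 0" "real (n - m) = real n - real m" "real n - real m > 0"
      using P by (auto simp: n_def)
    define a where "a = avg D (\<phi> D)"
    define b where "b = avg (P - D) (\<phi> D)"
    have sa: "sum (\<phi> D) D = m * a" using P BD by (simp add: a_def)
    have sb: "sum (\<phi> D) (P - D) = (real n - real m) * b" using n BD by (simp add: b_def)
    have "sum (\<phi> D) P = m * a + (real n - real m) * b"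
      using sum.subset_diff[OF BD(1) P(1), of "\<phi> D"] sa sb by simp
    \<comment> \<open>The average over \<open>P\<close> is a convex combination of \<open>a\<close>
      and \<open>b\<close>, so its distance from \<open>a\<close> is at most that of
      \<open>b\<close>.\<close>
    then have "n * (avg P (\<phi> D) - a) = (real n - real m) * (b - a)"
      using n by (simp add: n_def[symmetric] algebra_simps)
    then have "n * \<bar>avg P (\<phi> D) - a\<bar> = (real n - real m) * \<bar>b - a\<bar>"
      using n by (metis abs_mult abs_of_pos)
    also have "\<dots> \<le> n * \<bar>b - a\<bar>" by (intro mult_right_mono) auto
    finally have "\<bar>avg P (\<phi> D) - a\<bar> \<le> \<bar>b - a\<bar>" using n by simp
    then have "t < \<bar>b - a\<bar>" using dev[OF D] unfolding a_def by linarith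
    then have far: "t / 2 < \<bar>avg D' (\<phi> D) - a\<bar>" using close unfolding b_def by linarith
    have "sum (\<phi> D) D' = m * avg D' (\<phi> D)" using P D'2 by simp
    then have "sum (\<phi> D) (D \<union> D') = m * a + m * avg D' (\<phi> D)"
      using sa BD finD' disj by (simp add: sum.union_disjoint)
    \<comment> \<open>The two halves have equal size, so the union's average is the midpoint; this
      second halving explains \<open>t / 4\<close>.\<close>
    then have "avg (D \<union> D') (\<phi> D) - a = (avg D' (\<phi> D) - a) / 2"
      using P cU by (simp add: field_simps)
    moreover have "t / 4 < \<bar>z\<bar>" if "z = y / 2" "t / 2 < \<bar>y\<bar>" for z y using that by simp
    ultimately have "t / 4 < \<bar>avg (D \<union> D') (\<phi> D) - a\<bar>" using far by blast
    then have "t / 4 < \<bar>avg (D \<union> D') (\<phi> D) - avg D (\<phi> D)\<bar>" by (simp only: a_def)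
    moreover obtain C g where "finite C" "C \<noteq> {}" "card C \<le> k" "\<phi> D = (\<lambda>x. MIN u\<in>C. edist d x u - g u)"
      using \<phi>[OF D] by blast
    ultimately have "D \<in> bad_samples d k (t / 4) (D \<union> D') m"
      using BD unfolding bad_samples_def by auto
    then show "pair z \<in> (SIGMA S:subsets_of_size P (2 * m). bad_samples d k (t / 4) S m)"
      using cU BD D'2 by (auto simp: z pair_def)
  qed
  then have "card (SIGMA D:?B. G D) \<le> card (SIGMA S:subsets_of_size P (2 * m). bad_samples d k (t / 4) S m)"
    using P by (intro card_inj_on_le[OF inj]) (auto simp: bad_samples_def intro!: finite_SigmaI dest: finite_subset)
  also have "\<dots> = (\<Sum>S\<in>subsets_of_size P (2 * m). card (bad_samples d k (t / 4) S m))"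
    using P by (intro card_SigmaI) (auto simp: bad_samples_def dest: finite_subset)
  finally have "real (card (SIGMA D:?B. G D)) \<le> (\<Sum>S\<in>subsets_of_size P (2 * m). real (card (bad_samples d k (t / 4) S m)))"
    by (simp flip: of_nat_sum)
  also have "\<dots> \<le> (\<Sum>S\<in>subsets_of_size P (2 * m). \<eta> * (2 * m choose m))"
    by (intro sum_mono small)
  also have "\<dots> = \<eta> * ((n choose (2 * m)) * (2 * m choose m))"
    using n_subsets[OF P(1), of "2 * m"] by (simp add: n_def)
  \<comment> \<open>Choosing the union and then its first half is the same as choosing
    \<open>D\<close> and then the ghost from the complement.\<close>
  also have "(n choose (2 * m)) * (2 * m choose m) = (n choose m) * (n - m choose m)"
    using choose_mult[of m "2 * m" n] P by (simp add: n_def)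
  finally have up: "real (card (SIGMA D:?B. G D)) \<le> \<eta> * ((n choose m) * (n - m choose m))"
    by simp
  have "card ?B * real (n - m choose m) = (\<Sum>D\<in>?B. real (n - m choose m))" by simp
  also have "\<dots> \<le> (\<Sum>D\<in>?B. 2 * real (card (G D)))" by (intro sum_mono G_large)
  also have "\<dots> = 2 * real (card (SIGMA D:?B. G D))"
    using finB P by (subst card_SigmaI) (auto simp: G_def sum_distrib_left)
  finally have "card ?B * real (n - m choose m) \<le> 2 * \<eta> * (n choose m) * (n - m choose m)"
    using up by simp
  moreover have "real (n - m choose m) > 0" using P by (simp add: n_def)
  ultimately show ?thesis unfolding n_def by simp
qed

section \<open>The sample size\<close>

text \<open>Resolves the self-reference of a sample size that must exceed a multiple of its own
  logarithm.\<close>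

lemma le_of_soft_O_le:
  fixes f m :: real
  assumes "1 \<le> f" "2 ^ 41 * f * ln (2 + f) \<le> m"
  shows "2 ^ 34 * f * ln (4 * m) \<le> m"
proof -
  have l1: "1 \<le> ln (2 + f)"
    using assms exp_le by (subst ln_ge_iff) auto
  have "1 * 1 \<le> f * ln (2 + f)" using assms l1 by (intro mult_mono) auto
  then have m: "m > 0" using assms(2) by (simp add: mult.assoc)
  \<comment> \<open>The logarithm is linearised at this scale, so that the term
    \<open>4 * m / a\<close> contributes exactly \<open>m / 2\<close>.\<close>
  define a where "a = 2 ^ 37 * f"
  have a: "a > 0" using assms by (simp add: a_def)
  have "ln (4 * m) = ln (4 * m / a) + ln a" using m a by (simp add: ln_div)
  also have "\<dots> \<le> 4 * m / a + ln a" using ln_le_minus_one[of "4 * m / a"] m a by simp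
  also have "ln a \<le> 37 + ln (2 + f)"
  proof -
    have "ln a = 37 * ln 2 + ln f" using assms by (simp add: a_def ln_mult ln_realpow del: power_numeral)
    moreover have "ln 2 \<le> (1::real)" using ln_le_minus_one[of 2] by simp
    moreover have "ln f \<le> ln (2 + f)" using assms by simp
    ultimately show ?thesis by linarith
  qed
  also have "37 + ln (2 + f) \<le> 38 * ln (2 + f)" using l1 by simp
  finally have "2 ^ 34 * f * ln (4 * m) \<le> 2 ^ 34 * f * (4 * m / a + 38 * ln (2 + f))"
    using assms by (intro mult_left_mono) auto
  also have "\<dots> = m / 2 + 2 ^ 34 * 38 * (f * ln (2 + f))"
    using assms by (simp add: a_def distrib_left)
  also have "\<dots> \<le> m" using assms \<open>1 * 1 \<le> f * ln (2 + f)\<close> by (simp add: mult.assoc)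
  finally show ?thesis .
qed

section \<open>The sample size against the logarithm of the cover\<close>

context
  fixes \<epsilon> \<delta> :: real and k m :: nat
  assumes \<epsilon>: "0 < \<epsilon>" "\<epsilon> < 1" and \<delta>: "0 < \<delta>" "\<delta> < 1" and k: "1 \<le> k" and m: "1 \<le> m"
    and size: "2 ^ 34 * base_size k \<epsilon> \<delta> * ln (4 * real m) \<le> m"
begin

lemma ln_4m_ge_1: "1 \<le> ln (4 * real m)"
proof -
  have "exp 1 \<le> 4 * real m" using exp_le m by linarith
  then show ?thesis using m by (subst ln_ge_iff) auto
qed

lemma exponent_bound:
  "2 ^ 22 * (k * ln (4 * real m) / \<epsilon>\<^sup>2) + 4 * max 1 (ln (1 / \<delta>)) \<le> m * \<epsilon>\<^sup>2 / 2048"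
proof -
  define F where "F = max 1 (ln (1 / \<delta>))"
  define l where "l = ln (4 * real m)"
  define X where "X = k * F * l / \<epsilon>\<^sup>2"
  have F: "F \<ge> 1" and l: "l \<ge> 1" using ln_4m_ge_1 by (auto simp: F_def l_def)
  have e2: "0 < \<epsilon>\<^sup>2" "\<epsilon>\<^sup>2 \<le> 1" using \<epsilon> by (auto simp: power_le_one)
  have "k * l / \<epsilon>\<^sup>2 * 1 \<le> k * l / \<epsilon>\<^sup>2 * F" using F l by (intro mult_left_mono) auto
  then have 1: "k * l / \<epsilon>\<^sup>2 \<le> X" by (simp add: X_def mult_ac)
  have "1 * 1 \<le> real k * l" using k l by (intro mult_mono) auto
  then have "1 \<le> real k * l / \<epsilon>\<^sup>2" using e2 by (simp add: field_simps)
  then have "F * 1 \<le> F * (real k * l / \<epsilon>\<^sup>2)" using F by (intro mult_left_mono) auto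
  then have 2: "F \<le> X" by (simp add: X_def mult_ac)
  \<comment> \<open>As \<open>\<epsilon> < 1\<close>, the power 5 may be lowered to 4: two factors
    serve the Hoeffding exponent and two the cover exponent \<open>A\<close>.\<close>
  have "real k * F / \<epsilon> ^ 4 \<le> base_size k \<epsilon> \<delta>"
    unfolding base_size_def F_def[symmetric] using \<epsilon> F
    by (simp add: divide_left_mono power_decreasing)
  then have "2 ^ 34 * (real k * F / \<epsilon> ^ 4) * l \<le> 2 ^ 34 * base_size k \<epsilon> \<delta> * l"
    using l by (intro mult_right_mono mult_left_mono) auto
  also have "\<dots> \<le> m" using size by (simp add: l_def)
  finally have "2 ^ 34 * (real k * F / \<epsilon> ^ 4) * l * \<epsilon>\<^sup>2 \<le> m * \<epsilon>\<^sup>2"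
    by (intro mult_right_mono) auto
  moreover have "2 ^ 34 * (real k * F / \<epsilon> ^ 4) * l * \<epsilon>\<^sup>2 = 2 ^ 34 * X"
    using \<epsilon> by (simp add: X_def power2_eq_square power4_eq_xxxx)
  ultimately have "2 ^ 34 * X \<le> m * \<epsilon>\<^sup>2" by simp
  then have "2 ^ 23 * X \<le> m * \<epsilon>\<^sup>2 / 2048" by simp
  then have "2 ^ 22 * (k * l / \<epsilon>\<^sup>2) + 4 * F \<le> m * \<epsilon>\<^sup>2 / 2048" using 1 2 F by simp
  then show ?thesis by (simp add: F_def l_def)
qed

lemma ghost_sample_bound: "2 * exp (- (m * \<epsilon>\<^sup>2 / 32)) \<le> 1 / 2"
proof -
  have "0 \<le> 2 ^ 22 * (k * ln (4 * real m) / \<epsilon>\<^sup>2)" using ln_4m_ge_1 by simp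
  then have "4 \<le> m * \<epsilon>\<^sup>2 / 2048" using exponent_bound by linarith
  then have "4 \<le> exp (m * \<epsilon>\<^sup>2 / 32)" using exp_ge_add_one_self[of "m * \<epsilon>\<^sup>2 / 32"] by linarith
  then show ?thesis by (simp add: exp_minus field_simps)
qed

text \<open>Taking logarithms, one centre contributes at most \<open>4 * (A * l)\<close> with
  \<open>A\<close> at most \<open>2 ^ 20 / \<epsilon>\<^sup>2\<close>, which is the source of
  \<open>2 ^ 22\<close> in \<open>exponent_bound\<close>.\<close>

lemma union_bound:
  assumes N: "1 \<le> N" "N \<le> 2 * m" and A: "A = nat \<lceil>2 ^ 19 / \<epsilon>\<^sup>2\<rceil>"
  shows "real ((N * ((2 * N) ^ A * (Suc A * Suc A))) ^ k) * (2 * exp (- (m * \<epsilon>\<^sup>2 / 2048))) \<le> \<delta> / 2"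
proof -
  define l where "l = ln (4 * real m)"
  have l: "l \<ge> 1" using ln_4m_ge_1 by (simp add: l_def)
  define a where "a = real (N * ((2 * N) ^ A * (Suc A * Suc A)))"
  have a: "a > 0" using N unfolding a_def of_nat_0_less_iff by (simp del: mult_Suc mult_Suc_right)
  have e2: "0 < \<epsilon>\<^sup>2" "1 \<le> 1 / \<epsilon>\<^sup>2" using \<epsilon> by (auto simp: power_le_one)
  define y where "y = \<lceil>2 ^ 19 / \<epsilon>\<^sup>2\<rceil>"
  have "(0::real) < 2 ^ 19 / \<epsilon>\<^sup>2" using e2 by simp
  then have "0 < y" unfolding y_def by linarith
  then have A1: "1 \<le> A" and "real A = of_int y" unfolding A y_def[symmetric] by auto
  then have "real A \<le> 2 ^ 19 / \<epsilon>\<^sup>2 + 1" unfolding y_def by linarith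
  then have "real A \<le> 2 ^ 19 * (1 / \<epsilon>\<^sup>2) + 1" by simp
  moreover have "x \<le> 2 ^ 20 * z" if "x \<le> 2 ^ 19 * z + 1" "1 \<le> z" for x z :: real
    using that by simp
  ultimately have A2: "real A \<le> 2 ^ 20 * (1 / \<epsilon>\<^sup>2)" using e2(2) by blast
  have "ln a = ln (real N) + (A * ln (2 * real N) + (ln (1 + real A) + ln (1 + real A)))"
  proof -
    have "ln (n * (b ^ A * (c * c))) = ln n + (A * ln b + (ln c + ln c))"
      if "0 < n" "0 < b" "0 < c" for n b c :: real
      using that by (simp add: ln_mult ln_realpow)
    from this[of "real N" "2 * real N" "1 + real A"] show ?thesis
      using N unfolding a_def of_nat_mult of_nat_power of_nat_Suc of_nat_numeral by simp
  qed
  also have "\<dots> \<le> l + (A * l + (A * l + A * l))"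
  proof -
    have "ln (real N) \<le> l" "ln (2 * real N) \<le> l" using N unfolding l_def by simp_all
    moreover have "ln (1 + real A) \<le> A * l"
      using ln_le_minus_one[of "1 + real A"] mult_left_mono[of 1 l "real A"] l by simp
    ultimately show ?thesis by (intro add_mono mult_left_mono) auto
  qed
  also have "\<dots> \<le> 4 * (A * l)" using mult_right_mono[of 1 "real A" l] A1 l by simp
  also have "\<dots> \<le> 4 * (2 ^ 20 * (1 / \<epsilon>\<^sup>2) * l)" using A2 l by (intro mult_left_mono mult_right_mono) auto
  finally have "k * ln a \<le> k * (4 * (2 ^ 20 * (1 / \<epsilon>\<^sup>2) * l))" by (intro mult_left_mono) auto
  also have "\<dots> = 2 ^ 22 * (k * l / \<epsilon>\<^sup>2)" by simp
  finally have "k * ln a \<le> 2 ^ 22 * (k * l / \<epsilon>\<^sup>2)" .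
  \<comment> \<open>The 4 combines the factor of the two-sided tail with the halving of
    \<open>\<delta>\<close>; 3 and \<open>ln (1 / \<delta>)\<close> both fit into the reserve
    \<open>4 * max 1 (ln (1 / \<delta>))\<close>.\<close>
  moreover have "ln 4 \<le> (3::real)" using ln_le_minus_one[of 4] by simp
  ultimately have "k * ln a + ln 4 + ln (1 / \<delta>) \<le> m * \<epsilon>\<^sup>2 / 2048"
    using exponent_bound unfolding l_def by linarith
  then have "exp (k * ln a + ln 4 + ln (1 / \<delta>)) \<le> exp (m * \<epsilon>\<^sup>2 / 2048)"
    by (simp only: exp_le_cancel_iff)
  then have "exp (k * ln a) * 4 * (1 / \<delta>) \<le> exp (m * \<epsilon>\<^sup>2 / 2048)"
    using \<delta> by (simp add: exp_add)
  moreover have "exp (k * ln a) = a ^ k" using a by (simp add: exp_of_nat_mult)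
  ultimately show ?thesis unfolding of_nat_power a_def[symmetric] using \<delta> by (simp add: exp_minus field_simps)
qed

end

section \<open>From counting bad samples to the probability bound\<close>

theorem theorem4p1:
  "\<exists>K>0. \<exists>q::nat. \<forall>(d::nat) (c::pt) (r::real) (k::nat) (\<epsilon>::real) (\<delta>::real) (P::pt set) (n::nat) (m::nat).
     c \<in> Rspace d \<and> 0 < r \<and> 1 \<le> k \<and> 0 < \<epsilon> \<and> \<epsilon> < 1 \<and> 0 < \<delta> \<and> \<delta> < 1 \<and>
     finite P \<and> P \<subseteq> annulus d c r (2 * r) \<and> card P = n \<and>
     m \<le> n \<and> soft_O K q (base_size k \<epsilon> \<delta>) \<le> real m \<longrightarrow>
     measure_pmf.prob (uniform_sample P m)
       {D. assignment_preserving_coreset d k \<epsilon> (real n * r) P (\<lambda>x. 1) D (\<lambda>x. real n / real m)}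
     \<ge> 1 - \<delta>"
proof (intro exI[of _ "2 ^ 41 :: real"] conjI exI[of _ "1 :: nat"] allI impI)
  fix d c r k \<epsilon> \<delta> P n m
  assume "c \<in> Rspace d \<and> 0 < r \<and> 1 \<le> k \<and> 0 < \<epsilon> \<and> \<epsilon> < 1 \<and> 0 < \<delta> \<and> \<delta> < 1 \<and>
     finite P \<and> P \<subseteq> annulus d c r (2 * r) \<and> card P = n \<and>
     m \<le> n \<and> soft_O (2 ^ 41) 1 (base_size k \<epsilon> \<delta>) \<le> real m"
  then have r: "0 < r" and k: "1 \<le> k" and \<epsilon>: "0 < \<epsilon>" "\<epsilon> < 1" and \<delta>: "0 < \<delta>" "\<delta> < 1"
    and P: "finite P" "P \<subseteq> annulus d c r (2 * r)" "card P = n" and mn: "m \<le> n"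
    and soft: "2 ^ 41 * base_size k \<epsilon> \<delta> * ln (2 + base_size k \<epsilon> \<delta>) \<le> real m"
    by (auto simp: soft_O_def)
  have "1 \<le> real k / \<epsilon> ^ 5" using k \<epsilon> power_le_one[of \<epsilon> 5] by (simp add: field_simps)
  then have "1 * 1 \<le> base_size k \<epsilon> \<delta>" unfolding base_size_def by (intro mult_mono) auto
  then have f1: "1 \<le> base_size k \<epsilon> \<delta>" by simp
  have size: "2 ^ 34 * base_size k \<epsilon> \<delta> * ln (4 * real m) \<le> m"
    by (rule le_of_soft_O_le[OF f1 soft])
  have "0 < 2 ^ 41 * base_size k \<epsilon> \<delta> * ln (2 + base_size k \<epsilon> \<delta>)" using f1 by simp
  then have m: "1 \<le> m" using soft by simp
  note facts = \<epsilon> \<delta> k m size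
  \<comment> \<open>With ring diameter at most \<open>4 * r\<close> and deviation
    \<open>t / 4\<close>, the requirement on \<open>A\<close> becomes
    \<open>2 ^ 19 / \<epsilon>\<^sup>2\<close>, free of \<open>r\<close>.\<close>
  define A where "A = nat \<lceil>2 ^ 19 / \<epsilon>\<^sup>2\<rceil>"
  define t where "t = \<epsilon> * r"
  define R where "R = 4 * r"
  have tR: "0 < t / 4" "t / 4 \<le> R" "0 < t" "0 < R"
    using r \<epsilon> mult_right_mono[of \<epsilon> 1 r] by (auto simp: t_def R_def)
  have expo: "- real m * (t / 4)\<^sup>2 / (8 * R\<^sup>2) = - (m * \<epsilon>\<^sup>2 / 2048)"
    "- real m * t\<^sup>2 / (2 * R\<^sup>2) = - (m * \<epsilon>\<^sup>2 / 32)"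
    and ratio: "2048 * R\<^sup>2 / (t / 4)\<^sup>2 = 2 ^ 19 / \<epsilon>\<^sup>2"
    using r \<epsilon> by (simp_all add: t_def R_def power_mult_distrib power_divide)
  have diam: "edist d x y \<le> R" if "x \<in> P" "y \<in> P" for x y
  proof -
    have "edist d x c \<le> 2 * r" "edist d y c \<le> 2 * r" using that P by (auto simp: annulus_def)
    then show ?thesis
      using edist_triangle[of d x y c] edist_commute[of d y c] by (simp add: R_def)
  qed
  have A_ge: "2048 * R\<^sup>2 / (t / 4)\<^sup>2 \<le> real A"
    unfolding ratio A_def by linarith
  have small: "card (bad_samples d k (t / 4) S m) \<le> \<delta> / 2 * (card S choose m)"
    if S: "S \<subseteq> P" "m \<le> card S" "card S \<le> 2 * m" for S
  proof -
    have diamS: "edist d x y \<le> R" if "x \<in> S" "y \<in> S" for x y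
      using that S(1) diam by blast
    have "card (bad_samples d k (t / 4) S m) \<le>
      real ((card S * ((2 * card S) ^ A * (Suc A * Suc A))) ^ k) *
        (2 * (card S choose m) * exp (- real m * (t / 4)\<^sup>2 / (8 * R\<^sup>2)))"
      using S m P finite_subset[of S P]
      by (intro card_bad_samples_cover[OF _ _ _ diamS tR(1,2) A_ge]) auto
    also have "\<dots> = real ((card S * ((2 * card S) ^ A * (Suc A * Suc A))) ^ k) *
        (2 * exp (- (m * \<epsilon>\<^sup>2 / 2048))) * (card S choose m)"
      unfolding expo by simp
    also have "\<dots> \<le> \<delta> / 2 * (card S choose m)"
      using S m by (intro mult_right_mono union_bound[OF facts _ _ A_def]) auto
    finally show ?thesis .
  qed
  have bad: "card (bad_samples d k t P m) \<le> \<delta> * (n choose m)"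
  \<comment> \<open>If \<open>P\<close> has at most \<open>2 * m\<close> points, the cover is
    applied to \<open>P\<close> itself; otherwise there is room for a ghost sample and the cover is
    applied to sets of size \<open>2 * m\<close>.\<close>
  proof (cases "n \<le> 2 * m")
    case True
    have "bad_samples d k t P m \<subseteq> bad_samples d k (t / 4) P m"
      using tR(3) by (intro bad_samples_antimono) simp
    then have "card (bad_samples d k t P m) \<le> card (bad_samples d k (t / 4) P m)"
      using P by (intro card_mono) (simp_all add: bad_samples_def)
    then have "real (card (bad_samples d k t P m)) \<le> \<delta> / 2 * (n choose m)"
      using small[of P] True P mn by simp
    also have "\<dots> \<le> \<delta> * (n choose m)" using \<delta> by (intro mult_right_mono) auto
    finally show ?thesis .
  next
    case False
    have "card (bad_samples d k t P m) \<le> 2 * (\<delta> / 2) * (card P choose m)"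
    proof (rule card_bad_samples_symmetrization)
      show "2 * exp (- real m * t\<^sup>2 / (2 * R\<^sup>2)) \<le> 1 / 2"
        using ghost_sample_bound[OF facts] unfolding expo .
      show "card (bad_samples d k (t / 4) S m) \<le> \<delta> / 2 * (2 * m choose m)"
        if "S \<in> subsets_of_size P (2 * m)" for S
        using small[of S] that by simp
    qed (use False P m diam tR in auto)
    then show ?thesis using P by simp
  qed
  let ?good = "{D. assignment_preserving_coreset d k \<epsilon> (real n * r) P (\<lambda>x. 1) D (\<lambda>x. real n / real m)}"
  let ?S = "subsets_of_size P m"
  have cardS: "card ?S = (n choose m)" using n_subsets[OF P(1), of m] P by simp
  have finS: "finite ?S" using P by simp
  have pos: "0 < (n choose m)" using mn by simp
  then have neS: "?S \<noteq> {}" using cardS by (metis card.empty less_irrefl)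
  have "P \<subseteq> Rspace d" using P by (auto simp: annulus_def)
  then have "?S - bad_samples d k t P m \<subseteq> ?S \<inter> ?good"
    using coreset_if_not_bad[OF P(1) _ P(3), of d m \<epsilon> _ k r] m \<epsilon> by (auto simp: t_def)
  then have "card (?S - bad_samples d k t P m) \<le> card (?S \<inter> ?good)"
    using finS by (intro card_mono) auto
  moreover have sub: "bad_samples d k t P m \<subseteq> ?S" by (auto simp: bad_samples_def)
  have "card (?S - bad_samples d k t P m) = card ?S - card (bad_samples d k t P m)"
    by (rule card_Diff_subset[OF finite_subset[OF sub finS] sub])
  ultimately have "real (n choose m) - \<delta> * (n choose m) \<le> card (?S \<inter> ?good)"
    using bad cardS by linarith
  then have "1 - \<delta> \<le> card (?S \<inter> ?good) / card ?S"
    using pos cardS by (simp add: field_simps)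
  then show "1 - \<delta> \<le> measure_pmf.prob (uniform_sample P m) ?good"
    unfolding uniform_sample_def by (simp only: measure_pmf_of_set[OF neS finS])
qed simp

end
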